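(* Let $q$ be a prime power and for $n\geq 1$ let $a_n$ be the number of $n \times n$ semi-simple matrices over $\mathbf{F}_q$. Then $$1 + \sum_{n \geq 1} \frac{a_n}{\gamma_n} u^n= \prod_{d \geq 1}\left( 1 + \sum_{j \geq 1} \frac{u^{jd}}{\gamma_j(q^d) }\right)^{\nu_d}.$$
   Context: $\mathbf{F}_q$ is the field with $q$ elements. For a prime power $Q$, $\gamma_j(Q)=|\mathrm{GL}_j(Q)|=(Q^j-1)(Q^j-Q)\cdots(Q^j-Q^{j-1})$ is the order of the group of invertible $j\times j$ matrices over the field with $Q$ elements; $\gamma_n$ denotes $\gamma_n(q)$. $\nu_d$ is the number of monic irreducible polynomials of degree $d$ over $\mathbf{F}_q$. A matrix over $\mathbf{F}_q$ is semi-simple if it is diagonalizable over the algebraic closure of $\mathbf{F}_q$. The identity is one of formal power series in $u$. *)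

theory Defs
  imports
    "HOL-Algebra.Algebraic_Closure_Type"
    "HOL-Analysis.Infinite_Products"
    "HOL-Computational_Algebra.Formal_Power_Series"
    "Jordan_Normal_Form.Determinant"
begin

no_notation fps_nth (infixl "$" 75)
unbundle no vec_syntax

definition semisimple_mat :: "'a :: field mat \<Rightarrow> bool" where
  "semisimple_mat A \<longleftrightarrow> (\<exists>D. similar_mat (map_mat to_ac A) D \<and> diagonal_mat D)"

definition num_semisimple :: "'a :: {field,finite} itself \<Rightarrow> nat \<Rightarrow> nat" where
  "num_semisimple _ n = card {A :: 'a mat. A \<in> carrier_mat n n \<and> semisimple_mat A}"

definition num_monic_irreducible :: "'a :: {field,finite} itself \<Rightarrow> nat \<Rightarrow> nat" where
  "num_monic_irreducible _ d =
     card {p :: 'a poly. lead_coeff p = 1 \<and> irreducible p \<and> degree p = d}"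

text \<open>The order of the general linear group of rank \<open>j\<close> over the field with \<open>Q\<close> elements
  (see \<open>card_invertible_mat\<close> below). It is given by a formula in \<open>Q\<close>, since it is needed
  at every power of the order of a finite field and not just at the orders of given types.\<close>

definition GL_order :: "nat \<Rightarrow> nat \<Rightarrow> nat" where
  "GL_order j Q = (\<Prod>i<j. Q ^ j - Q ^ i)"

context
  fixes n :: nat and ty :: "'a :: {field,finite} itself"
begin

private definition inj_mats :: "nat \<Rightarrow> 'a mat set" where
  "inj_mats k = {A \<in> carrier_mat n k. \<forall>v \<in> carrier_vec k. A *\<^sub>v v = 0\<^sub>v n \<longrightarrow> v = 0\<^sub>v k}"

private definition ext :: "nat \<Rightarrow> 'a mat \<times> 'a vec \<Rightarrow> 'a mat" where
  "ext k = (\<lambda>(A, b). mat n (Suc k) (\<lambda>(i,j). if j < k then A $$ (i,j) else b $ i))"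

private lemma card_vecs: "card (carrier_vec k :: 'a vec set) = CARD('a) ^ k"
proof -
  have "bij_betw list_of_vec (carrier_vec k :: 'a vec set) {xs. set xs \<subseteq> UNIV \<and> length xs = k}"
    by (rule bij_betw_byWitness[where f' = vec_of_list]) (auto simp: vec_list list_vec intro: carrier_vecI)
  then show ?thesis
    using card_lists_length_eq[of "UNIV :: 'a set" k] by (simp add: bij_betw_same_card)
qed

private lemma finite_vecs: "finite (carrier_vec k :: 'a vec set)"
  by (rule card_ge_0_finite) (simp add: card_vecs)

private lemma ext_mult:
  assumes "A \<in> carrier_mat n k" "b \<in> carrier_vec n" "v \<in> carrier_vec (Suc k)"
  shows "ext k (A, b) *\<^sub>v v = A *\<^sub>v vec k (($) v) + v $ k \<cdot>\<^sub>v b"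
proof (rule eq_vecI)
  fix i assume "i < dim_vec (A *\<^sub>v vec k (($) v) + v $ k \<cdot>\<^sub>v b)"
  then have i: "i < n" using assms by simp
  have "(ext k (A, b) *\<^sub>v v) $ i
      = (\<Sum>j<Suc k. (if j < k then A $$ (i,j) else b $ i) * v $ j)"
    using assms i by (simp add: ext_def scalar_prod_def atLeast0LessThan)
  also have "\<dots> = (\<Sum>j<k. A $$ (i,j) * v $ j) + b $ i * v $ k"
    by simp
  also have "\<dots> = (A *\<^sub>v vec k (($) v) + v $ k \<cdot>\<^sub>v b) $ i"
    using assms i by (simp add: scalar_prod_def atLeast0LessThan mult.commute)
  finally show "(ext k (A, b) *\<^sub>v v) $ i = (A *\<^sub>v vec k (($) v) + v $ k \<cdot>\<^sub>v b) $ i" .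
qed (use assms in \<open>simp add: ext_def\<close>)

private lemma ext_inj_iff:
  assumes A: "A \<in> carrier_mat n k" and b: "b \<in> carrier_vec n"
  shows "ext k (A, b) \<in> inj_mats (Suc k) \<longleftrightarrow>
           A \<in> inj_mats k \<and> b \<notin> (\<lambda>v. A *\<^sub>v v) ` carrier_vec k"
proof
  assume L: "ext k (A, b) \<in> inj_mats (Suc k)"
  have inj: "v = 0\<^sub>v (Suc k)"
    if "v \<in> carrier_vec (Suc k)" "A *\<^sub>v vec k (($) v) + v $ k \<cdot>\<^sub>v b = 0\<^sub>v n" for v
    using L that ext_mult[OF A b that(1)] by (auto simp: inj_mats_def)
  have "v = 0\<^sub>v k" if v: "v \<in> carrier_vec k" "A *\<^sub>v v = 0\<^sub>v n" for v
  proof -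
    let ?w = "vec (Suc k) (\<lambda>i. if i < k then v $ i else 0)"
    have "vec k (($) ?w) = v" using v by (auto simp: vec_eq_iff)
    then have "?w = 0\<^sub>v (Suc k)" using v b by (intro inj) auto
    then have "?w $ i = 0" if "i < k" for i using that by simp
    then show ?thesis using v by (auto simp: vec_eq_iff)
  qed
  moreover have False if v: "v \<in> carrier_vec k" "b = A *\<^sub>v v" for v
  proof -
    let ?w = "vec (Suc k) (\<lambda>i. if i < k then v $ i else -1)"
    have w: "vec k (($) ?w) = v" using v by (auto simp: vec_eq_iff)
    have "A *\<^sub>v vec k (($) ?w) + ?w $ k \<cdot>\<^sub>v b = 0\<^sub>v n"
      unfolding w using A b v by (auto simp: vec_eq_iff)
    then have "?w = 0\<^sub>v (Suc k)" by (intro inj) auto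
    then have "?w $ k = 0" by simp
    then show False by simp
  qed
  ultimately show "A \<in> inj_mats k \<and> b \<notin> (\<lambda>v. A *\<^sub>v v) ` carrier_vec k"
    using A by (auto simp: inj_mats_def)
next
  assume R: "A \<in> inj_mats k \<and> b \<notin> (\<lambda>v. A *\<^sub>v v) ` carrier_vec k"
  have "v = 0\<^sub>v (Suc k)"
    if v: "v \<in> carrier_vec (Suc k)" and "ext k (A, b) *\<^sub>v v = 0\<^sub>v n" for v
  proof -
    let ?u = "vec k (($) v)"
    have e: "A *\<^sub>v ?u + v $ k \<cdot>\<^sub>v b = 0\<^sub>v n"
      using that ext_mult[OF A b v] by simp
    have "v $ k = 0"
    proof (rule ccontr)
      assume nz: "v $ k \<noteq> 0"
      have "b = A *\<^sub>v ((- inverse (v $ k)) \<cdot>\<^sub>v ?u)"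
      proof (rule eq_vecI)
        fix i assume "i < dim_vec (A *\<^sub>v ((- inverse (v $ k)) \<cdot>\<^sub>v ?u))"
        then have i: "i < n" using A by simp
        have "(A *\<^sub>v ?u + v $ k \<cdot>\<^sub>v b) $ i = 0" using e i by simp
        then have "(A *\<^sub>v ?u) $ i = - (v $ k * b $ i)" 
          using i A b by (simp add: eq_neg_iff_add_eq_0)
        moreover have "A *\<^sub>v ((- inverse (v $ k)) \<cdot>\<^sub>v ?u) = (- inverse (v $ k)) \<cdot>\<^sub>v (A *\<^sub>v ?u)"
          by (rule mult_mat_vec[OF A]) simp
        ultimately show "b $ i = (A *\<^sub>v ((- inverse (v $ k)) \<cdot>\<^sub>v ?u)) $ i"
          using i A b nz by (simp del: index_mult_mat_vec add: index_smult_vec)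
      qed (use A b in auto)
      then show False using R by (metis image_eqI smult_carrier_vec vec_carrier)
    qed
    moreover from this have "A *\<^sub>v ?u = 0\<^sub>v n"
      using e A b by (simp add: vec_eq_iff)
    then have "?u = 0\<^sub>v k" using R by (auto simp: inj_mats_def)
    then have "v $ i = 0" if "i < k" for i using that by (metis index_vec index_zero_vec(1))
    ultimately show ?thesis using v by (auto simp: vec_eq_iff less_Suc_eq)
  qed
  then show "ext k (A, b) \<in> inj_mats (Suc k)"
    by (auto simp: inj_mats_def ext_def)
qed

private lemma ext_bij:
  "bij_betw (ext k) (SIGMA A:inj_mats k. carrier_vec n - (\<lambda>v. A *\<^sub>v v) ` carrier_vec k)
     (inj_mats (Suc k))"
proof (rule bij_betw_byWitness[where
      f' = "\<lambda>B. (mat n k (\<lambda>(i,j). B $$ (i,j)), vec n (\<lambda>i. B $$ (i,k)))"])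
  have *: "ext k (mat n k (\<lambda>(i,j). B $$ (i,j)), vec n (\<lambda>i. B $$ (i,k))) = B"
    if "B \<in> inj_mats (Suc k)" for B
    using that by (auto simp: inj_mats_def ext_def mat_eq_iff less_Suc_eq)
  then show "\<forall>B\<in>inj_mats (Suc k).
      ext k (mat n k (\<lambda>(i,j). B $$ (i,j)), vec n (\<lambda>i. B $$ (i,k))) = B" by blast
  show "(\<lambda>B. (mat n k (\<lambda>(i,j). B $$ (i,j)), vec n (\<lambda>i. B $$ (i,k)))) ` inj_mats (Suc k)
      \<subseteq> (SIGMA A:inj_mats k. carrier_vec n - (\<lambda>v. A *\<^sub>v v) ` carrier_vec k)"
  proof (rule image_subsetI)
    fix B :: "'a mat" assume B: "B \<in> inj_mats (Suc k)"
    let ?A = "mat n k (\<lambda>(i,j). B $$ (i,j))" and ?b = "vec n (\<lambda>i. B $$ (i,k))"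
    have "ext k (?A, ?b) \<in> inj_mats (Suc k)" using * B by simp
    then have "?A \<in> inj_mats k \<and> ?b \<notin> (\<lambda>v. ?A *\<^sub>v v) ` carrier_vec k"
      by (subst (asm) ext_inj_iff) auto
    then show "(?A, ?b) \<in> (SIGMA A:inj_mats k. carrier_vec n - (\<lambda>v. A *\<^sub>v v) ` carrier_vec k)"
      by auto
  qed
  show "\<forall>p\<in>(SIGMA A:inj_mats k. carrier_vec n - (\<lambda>v. A *\<^sub>v v) ` carrier_vec k).
      (mat n k (\<lambda>(i,j). ext k p $$ (i,j)), vec n (\<lambda>i. ext k p $$ (i,k))) = p"
    by (auto simp: inj_mats_def ext_def mat_eq_iff vec_eq_iff)
  show "ext k ` (SIGMA A:inj_mats k. carrier_vec n - (\<lambda>v. A *\<^sub>v v) ` carrier_vec k)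
      \<subseteq> inj_mats (Suc k)"
  proof (rule image_subsetI)
    fix p assume "p \<in> (SIGMA A:inj_mats k. carrier_vec n - (\<lambda>v. A *\<^sub>v v) ` carrier_vec k)"
    then show "ext k p \<in> inj_mats (Suc k)"
      by (cases p) (use ext_inj_iff in \<open>auto simp: inj_mats_def\<close>)
  qed
qed

private lemma card_image_inj_mat:
  assumes "A \<in> inj_mats k"
  shows "card ((\<lambda>v. A *\<^sub>v v) ` carrier_vec k) = CARD('a) ^ k"
proof -
  have A: "A \<in> carrier_mat n k" using assms by (simp add: inj_mats_def)
  have "inj_on (\<lambda>v. A *\<^sub>v v) (carrier_vec k)"
  proof (rule inj_onI)
    fix v w :: "'a vec"
    assume v: "v \<in> carrier_vec k" and w: "w \<in> carrier_vec k" and eq: "A *\<^sub>v v = A *\<^sub>v w"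
    have "A *\<^sub>v (v - w) = A *\<^sub>v v - A *\<^sub>v w"
      by (rule mult_minus_distrib_mat_vec[OF A v w])
    also have "\<dots> = 0\<^sub>v n" using eq A w by (auto simp: vec_eq_iff)
    finally have "v - w = 0\<^sub>v k" using assms v w by (auto simp: inj_mats_def)
    then have "(v - w) $ i = 0" if "i < k" for i using that by simp
    then show "v = w" using v w by (auto simp: vec_eq_iff)
  qed
  then show ?thesis by (simp add: card_image card_vecs)
qed

private lemma card_inj_mats:
  "finite (inj_mats k) \<and> card (inj_mats k) = (\<Prod>i<k. CARD('a) ^ n - CARD('a) ^ i)"
proof (induction k)
  case 0
  have "inj_mats 0 = {mat n 0 (\<lambda>_. 0)}"
    by (auto simp: inj_mats_def mat_eq_iff)
  then show ?case by simp
next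
  case (Suc k)
  let ?S = "SIGMA A:inj_mats k. carrier_vec n - (\<lambda>v. A *\<^sub>v v) ` carrier_vec k"
  have "card (carrier_vec n - (\<lambda>v. A *\<^sub>v v) ` carrier_vec k) = CARD('a) ^ n - CARD('a) ^ k"
    if "A \<in> inj_mats k" for A
  proof (subst card_Diff_subset)
    show "(\<lambda>v. A *\<^sub>v v) ` carrier_vec k \<subseteq> carrier_vec n"
      using that by (auto simp: inj_mats_def)
  qed (use that in \<open>simp_all add: finite_vecs card_image_inj_mat card_vecs\<close>)
  then have "card ?S = (\<Prod>i<Suc k. CARD('a) ^ n - CARD('a) ^ i)"
    using Suc by (subst card_SigmaI) (auto simp: finite_vecs)
  moreover have "finite ?S" using Suc by (intro finite_SigmaI) (auto simp: finite_vecs)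
  ultimately show ?case
    using bij_betw_same_card[OF ext_bij] bij_betw_finite[OF ext_bij] by metis
qed

lemma card_invertible_mat:
  "card {A :: 'a mat. A \<in> carrier_mat n n \<and> invertible_mat A} = GL_order n CARD('a)"
proof -
  have "{A :: 'a mat. A \<in> carrier_mat n n \<and> invertible_mat A} = inj_mats n"
  proof (intro Set.equalityI subsetI)
    fix A :: "'a mat" assume "A \<in> {A. A \<in> carrier_mat n n \<and> invertible_mat A}"
    then obtain B where A: "A \<in> carrier_mat n n" and AB: "A * B = 1\<^sub>m n"
      and BA: "B * A = 1\<^sub>m (dim_row B)"
      by (auto simp: invertible_mat_def inverts_mat_def)
    have B: "B \<in> carrier_mat n n"
      using A arg_cong[OF AB, of dim_col] arg_cong[OF BA, of dim_col] by auto
    have "v = 0\<^sub>v n" if v: "v \<in> carrier_vec n" "A *\<^sub>v v = 0\<^sub>v n" for v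
    proof -
      have "v = (B * A) *\<^sub>v v" using BA B v by simp
      also have "\<dots> = B *\<^sub>v (A *\<^sub>v v)" using A B v by (intro assoc_mult_mat_vec) auto
      also have "\<dots> = 0\<^sub>v n" unfolding v(2) using B by (auto simp: vec_eq_iff)
      finally show ?thesis .
    qed
    then show "A \<in> inj_mats n" using A by (auto simp: inj_mats_def)
  next
    fix A :: "'a mat" assume "A \<in> inj_mats n"
    then have A: "A \<in> carrier_mat n n" and "det A \<noteq> 0"
      by (auto simp: inj_mats_def det_0_iff_vec_prod_zero_field)
    then have "A \<in> Units (ring_mat TYPE('a) n ())" by (rule det_non_zero_imp_unit)
    then show "A \<in> {A. A \<in> carrier_mat n n \<and> invertible_mat A}"
      using A by (auto simp: Units_def ring_mat_def invertible_mat_def inverts_mat_def)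
  qed
  then show ?thesis by (simp add: card_inj_mats GL_order_def)
qed

end

end

theory Submission
  imports Defs "Jordan_Normal_Form.Char_Poly"
begin

text \<open>
  Write \<open>q\<close> for the order of the field and \<open>N f n\<close> for the number of \<open>n\<close> by \<open>n\<close> matrices \<open>A\<close> with
  \<open>f(A) = 0\<close>. To a polynomial \<open>f\<close> belongs the series \<open>annihilated_gf f\<close> with coefficients
  \<open>N f n / card (GL n)\<close>. By the orbit formula for conjugation this is the sum of the inverse orders
  of the automorphism groups of the \<open>n\<close>-dimensional modules over \<open>K[X]/(f)\<close>, up to isomorphism.
  The theorem follows from three properties of these series.

  They are multiplicative over coprime factors (\<open>annihilated_gf_mult\<close>). If \<open>f\<close> and \<open>g\<close> are coprime
  and \<open>(f g)(A) = 0\<close>, then the space is the direct sum of the kernels of \<open>f(A)\<close> and \<open>g(A)\<close>. Pairs of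
  such an \<open>A\<close> and a basis that is adapted to this decomposition are counted in two ways.

  For irreducible \<open>f\<close> of degree \<open>d\<close> the series is a factor of the product on the right
  (\<open>annihilated_gf_irreducible\<close>). A matrix \<open>A\<close> with \<open>f(A) = 0\<close> makes the space a vector space over
  the field \<open>K[X]/(f)\<close> with \<open>q ^ d\<close> elements, so that \<open>n = j d\<close>. Pairs of such an \<open>A\<close> and a basis
  over this larger field are again counted in two ways: \<open>A\<close> has \<open>GL_order j (q ^ d)\<close> bases, and every
  invertible matrix over the base field arises from exactly one pair. The larger field is never
  constructed. In a basis over it, every vector \<open>v\<close> is represented by its Krylov block
  \<open>v, A v, \<dots>, A ^ (d - 1) v\<close>, and linear independence becomes injectivity of a matrix over the
  base field.

  A matrix of size at most \<open>D\<close> is semisimple if and only if it is annihilated by the product \<open>M\<close> of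
  all monic irreducible polynomials of degree at most \<open>D\<close> (\<open>semisimple_iff_annihilated\<close>). Indeed the
  eigenvalues of a semisimple matrix are roots of the characteristic polynomial and so of \<open>M\<close>, while
  \<open>M\<close> divides some \<open>X ^ (p ^ k) - X\<close>, where \<open>p\<close> is the characteristic, and so has only simple
  roots, which makes every matrix annihilated by \<open>M\<close> diagonalizable over the algebraic closure.

  By the first two properties the product over all \<open>d \<le> D\<close> equals \<open>annihilated_gf M\<close>, and by the
  third one its coefficients up to \<open>D\<close> are those of the series of semisimple matrices. Hence each
  coefficient of the partial products is eventually constant, which is convergence of formal power
  series.
\<close>

section \<open>Polynomials evaluated at a matrix\<close>

text \<open>Horner evaluation, so that induction on \<open>pCons\<close> applies directly. The result is
  \<open>dim_row A\<close> square; all statements about it concern square \<open>A\<close>.\<close>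

definition poly_mat :: "'a :: comm_ring_1 poly \<Rightarrow> 'a mat \<Rightarrow> 'a mat" where
  "poly_mat p A = fold_coeffs (\<lambda>a B. a \<cdot>\<^sub>m 1\<^sub>m (dim_row A) + A * B) p (0\<^sub>m (dim_row A) (dim_row A))"

lemma poly_mat_0: "A \<in> carrier_mat n n \<Longrightarrow> poly_mat 0 A = 0\<^sub>m n n"
  by (simp add: poly_mat_def)

lemma poly_mat_pCons:
  assumes A: "A \<in> carrier_mat n n"
  shows "poly_mat (pCons a p) A = a \<cdot>\<^sub>m 1\<^sub>m n + A * poly_mat p A"
proof (cases "a = 0 \<and> p = 0")
  case True
  then show ?thesis using A by (simp add: poly_mat_0) (auto simp: mat_eq_iff)
next
  case False
  then have "cCons a (coeffs p) = a # coeffs p" by (auto simp: cCons_def)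
  then show ?thesis using A by (simp add: poly_mat_def fold_coeffs_def)
qed

lemma poly_mat_carrier [simp]:
  assumes "A \<in> carrier_mat n n" shows "poly_mat p A \<in> carrier_mat n n"
  by (induction p) (use assms in \<open>simp_all add: poly_mat_0 poly_mat_pCons\<close>)

lemma poly_mat_dim [simp]:
  assumes "A \<in> carrier_mat n n"
  shows "dim_row (poly_mat p A) = n" "dim_col (poly_mat p A) = n"
  using poly_mat_carrier[OF assms, of p] by auto

lemma poly_mat_const: "A \<in> carrier_mat n n \<Longrightarrow> poly_mat [:c:] A = c \<cdot>\<^sub>m 1\<^sub>m n"
  by (simp add: poly_mat_pCons poly_mat_0)

lemma poly_mat_1: "A \<in> carrier_mat n n \<Longrightarrow> poly_mat 1 A = 1\<^sub>m n"
  by (simp add: one_pCons poly_mat_const mat_eq_iff)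

lemma poly_mat_linear:
  "A \<in> carrier_mat n n \<Longrightarrow> poly_mat [:a, 1:] A = a \<cdot>\<^sub>m 1\<^sub>m n + A"
  by (simp add: poly_mat_pCons poly_mat_0 mat_eq_iff)

lemma poly_mat_add:
  assumes A: "A \<in> carrier_mat n n"
  shows "poly_mat (p + q) A = poly_mat p A + poly_mat q A"
proof (induction p arbitrary: q)
  case 0
  show ?case using A by (simp add: poly_mat_0)
next
  case (pCons a p)
  obtain b r where q: "q = pCons b r" by (cases q)
  have "A * (poly_mat p A + poly_mat r A) = A * poly_mat p A + A * poly_mat r A"
    using A by (intro mult_add_distrib_mat[of _ n n _ n]) auto
  then show ?case
    using A pCons.IH[of r] unfolding q
    by (simp add: poly_mat_pCons) (auto simp: mat_eq_iff algebra_simps)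
qed

lemma poly_mat_smult:
  assumes A: "A \<in> carrier_mat n n"
  shows "poly_mat (smult c p) A = c \<cdot>\<^sub>m poly_mat p A"
proof (induction p)
  case 0
  show ?case using A by (simp add: poly_mat_0)
next
  case (pCons a p)
  have "A * (c \<cdot>\<^sub>m poly_mat p A) = c \<cdot>\<^sub>m (A * poly_mat p A)"
    using A by (intro mult_smult_distrib[of _ n n _ n]) auto
  then show ?case
    using A pCons.IH by (simp add: poly_mat_pCons) (auto simp: mat_eq_iff algebra_simps)
qed

lemma poly_mat_mult:
  assumes A: "A \<in> carrier_mat n n"
  shows "poly_mat (p * q) A = poly_mat p A * poly_mat q A"
proof (induction p)
  case 0
  show ?case using A by (simp add: poly_mat_0 left_mult_zero_mat[OF poly_mat_carrier[OF A]])
next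
  case (pCons a p)
  have "(a \<cdot>\<^sub>m 1\<^sub>m n + A * poly_mat p A) * poly_mat q A
      = a \<cdot>\<^sub>m 1\<^sub>m n * poly_mat q A + A * poly_mat p A * poly_mat q A"
    using A by (intro add_mult_distrib_mat[of _ n n _ _ n]) auto
  also have "a \<cdot>\<^sub>m 1\<^sub>m n * poly_mat q A = a \<cdot>\<^sub>m poly_mat q A"
    using A by (subst mult_smult_assoc_mat[of _ n n _ n]) auto
  also have "A * poly_mat p A * poly_mat q A = A * (poly_mat p A * poly_mat q A)"
    using A by (intro assoc_mult_mat[of _ n n _ n _ n]) auto
  finally show ?case
    using A pCons.IH
    by (simp add: poly_mat_add poly_mat_smult poly_mat_pCons) (auto simp: mat_eq_iff)
qed

lemma poly_mat_dvd:
  assumes A: "A \<in> carrier_mat n n" and "p dvd q" "poly_mat p A = 0\<^sub>m n n"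
  shows "poly_mat q A = 0\<^sub>m n n"
  using assms by (auto simp: poly_mat_mult left_mult_zero_mat[OF poly_mat_carrier[OF A]] elim!: dvdE)

text \<open>An equation \<open>A * B = B * C\<close> with a rectangular \<open>B\<close> says that the columns of \<open>B\<close> carry a
  \<open>C\<close>-action inside the space on which \<open>A\<close> acts. All transport of polynomial identities between
  a matrix, its restrictions to invariant subspaces, its conjugates and its blocks goes through
  this lemma. With \<open>A = B = C\<close> it says that \<open>A\<close> commutes with its polynomials.\<close>

lemma poly_mat_intertwine:
  assumes A: "A \<in> carrier_mat n n" and B: "B \<in> carrier_mat n k" and C: "C \<in> carrier_mat k k"
    and eq: "A * B = B * C"
  shows "poly_mat p A * B = B * poly_mat p C"
proof (induction p)
  case 0
  show ?case using A B C by (simp add: poly_mat_0)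
next
  case (pCons a p)
  have "(a \<cdot>\<^sub>m 1\<^sub>m n + A * poly_mat p A) * B = a \<cdot>\<^sub>m 1\<^sub>m n * B + A * poly_mat p A * B"
    using A B by (intro add_mult_distrib_mat[of _ n n _ _ k]) auto
  also have "a \<cdot>\<^sub>m 1\<^sub>m n * B = B * (a \<cdot>\<^sub>m 1\<^sub>m k)"
    using B by (subst mult_smult_assoc_mat[of _ n n _ k]) (auto simp: mult_smult_distrib)
  also have "A * poly_mat p A * B = A * (poly_mat p A * B)"
    using A B by (intro assoc_mult_mat[of _ n n _ n _ k]) auto
  also have "\<dots> = A * B * poly_mat p C"
    unfolding pCons.IH using A B C by (intro assoc_mult_mat[of _ n n _ k _ k, symmetric]) auto
  also have "\<dots> = B * (C * poly_mat p C)"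
    unfolding eq using B C by (intro assoc_mult_mat[of _ n k _ k _ k]) auto
  also have "B * (a \<cdot>\<^sub>m 1\<^sub>m k) + B * (C * poly_mat p C) = B * (a \<cdot>\<^sub>m 1\<^sub>m k + C * poly_mat p C)"
    using B C by (intro mult_add_distrib_mat[of _ n k _ k, symmetric]) auto
  finally show ?case using A C by (simp add: poly_mat_pCons)
qed

text \<open>The vector is written through iterates of \<open>A\<close> rather than through powers of \<open>A\<close>, because
  these iterates are the columns of Krylov blocks.\<close>

lemma poly_mat_mult_vec:
  assumes A: "A \<in> carrier_mat n n" and v: "v \<in> carrier_vec n" and "degree p < N"
  shows "poly_mat p A *\<^sub>v v = vec n (\<lambda>r. \<Sum>i<N. coeff p i * (((\<lambda>w. A *\<^sub>v w) ^^ i) v) $ r)"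
  using v \<open>degree p < N\<close>
proof (induction p arbitrary: v N)
  case 0
  then show ?case using A by (auto simp: poly_mat_0 vec_eq_iff)
next
  case (pCons a p)
  obtain M where N: "N = Suc M" using pCons.prems by (cases N) auto
  have Av: "A *\<^sub>v v \<in> carrier_vec n" using A pCons.prems by auto
  have deg: "p = 0 \<or> degree p < M"
    using pCons.prems N by (auto split: if_splits)
  have IH: "poly_mat p A *\<^sub>v (A *\<^sub>v v)
      = vec n (\<lambda>r. \<Sum>i<M. coeff p i * (((\<lambda>w. A *\<^sub>v w) ^^ i) (A *\<^sub>v v)) $ r)"
    using deg
  proof
    assume "p = 0" then show ?thesis using A Av by (auto simp: poly_mat_0 vec_eq_iff)
  qed (use pCons.IH[OF Av] in simp)
  have comm: "A * poly_mat p A = poly_mat p A * A"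
    using poly_mat_intertwine[OF A A A refl] by simp
  have "(a \<cdot>\<^sub>m 1\<^sub>m n + A * poly_mat p A) *\<^sub>v v = a \<cdot>\<^sub>m 1\<^sub>m n *\<^sub>v v + (poly_mat p A * A) *\<^sub>v v"
    unfolding comm using A pCons.prems by (intro add_mult_distrib_mat_vec[of _ n n]) (auto intro!: mult_carrier_mat)
  also have "(poly_mat p A * A) *\<^sub>v v = poly_mat p A *\<^sub>v (A *\<^sub>v v)"
    using A pCons.prems by (intro assoc_mult_mat_vec[of _ n n _ n]) auto
  also have "a \<cdot>\<^sub>m 1\<^sub>m n *\<^sub>v v = a \<cdot>\<^sub>v v" 
    using pCons.prems by auto
  finally show ?case
    unfolding IH N sum.lessThan_Suc_shift using A pCons.prems
    by (simp add: poly_mat_pCons vec_eq_iff funpow_Suc_right del: funpow.simps)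
qed

section \<open>Block matrices\<close>

definition diag_sum :: "'a :: zero mat \<Rightarrow> 'a mat \<Rightarrow> 'a mat" where
  "diag_sum A B = four_block_mat A (0\<^sub>m (dim_row A) (dim_col B)) (0\<^sub>m (dim_row B) (dim_col A)) B"

text \<open>The lower blocks have no rows; they are only there to reuse the block calculus of
  \<open>four_block_mat\<close>.\<close>

definition hcat :: "'a :: zero mat \<Rightarrow> 'a mat \<Rightarrow> 'a mat" where
  "hcat A B = four_block_mat A B (0\<^sub>m 0 (dim_col A)) (0\<^sub>m 0 (dim_col B))"

lemma diag_sum_carrier [simp]:
  "A \<in> carrier_mat n k \<Longrightarrow> B \<in> carrier_mat m l \<Longrightarrow> diag_sum A B \<in> carrier_mat (n + m) (k + l)"
  by (auto simp: diag_sum_def)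

lemma hcat_carrier [simp]:
  "A \<in> carrier_mat n k \<Longrightarrow> B \<in> carrier_mat n l \<Longrightarrow> hcat A B \<in> carrier_mat n (k + l)"
  by (auto simp: hcat_def)

lemma hcat_eq_iff:
  assumes "A \<in> carrier_mat n k" "B \<in> carrier_mat n l" "A' \<in> carrier_mat n k" "B' \<in> carrier_mat n l"
  shows "hcat A B = hcat A' B' \<longleftrightarrow> A = A' \<and> B = B'"
proof
  assume eq: "hcat A B = hcat A' B'"
  have "A $$ (i,j) = A' $$ (i,j)" if "i < n" "j < k" for i j
    using arg_cong[OF eq, of "\<lambda>M. M $$ (i,j)"] that assms by (simp add: hcat_def)
  moreover have "B $$ (i,j) = B' $$ (i,j)" if "i < n" "j < l" for i j
    using arg_cong[OF eq, of "\<lambda>M. M $$ (i,k + j)"] that assms by (simp add: hcat_def)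
  ultimately show "A = A' \<and> B = B'" using assms by (auto simp: mat_eq_iff)
qed auto

lemma diag_sum_eq_iff:
  assumes "A \<in> carrier_mat k k" "B \<in> carrier_mat l l" "A' \<in> carrier_mat k k" "B' \<in> carrier_mat l l"
  shows "diag_sum A B = diag_sum A' B' \<longleftrightarrow> A = A' \<and> B = B'"
proof
  assume eq: "diag_sum A B = diag_sum A' B'"
  have "A $$ (i,j) = A' $$ (i,j)" if "i < k" "j < k" for i j
    using arg_cong[OF eq, of "\<lambda>M. M $$ (i,j)"] that assms by (simp add: diag_sum_def)
  moreover have "B $$ (i,j) = B' $$ (i,j)" if "i < l" "j < l" for i j
    using arg_cong[OF eq, of "\<lambda>M. M $$ (k + i,k + j)"] that assms by (simp add: diag_sum_def)
  ultimately show "A = A' \<and> B = B'" using assms by (auto simp: mat_eq_iff)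
qed auto

lemma hcat_split:
  assumes "K \<in> carrier_mat n (k + l)"
  obtains A B where "A \<in> carrier_mat n k" "B \<in> carrier_mat n l" "K = hcat A B"
proof
  show "K = hcat (mat n k (\<lambda>(i,j). K $$ (i,j))) (mat n l (\<lambda>(i,j). K $$ (i,k + j)))"
    using assms by (auto simp: hcat_def mat_eq_iff)
qed auto

lemma mult_hcat:
  assumes "M \<in> carrier_mat m n" "A \<in> carrier_mat n k" "B \<in> carrier_mat n l"
  shows "M * hcat A B = hcat (M * A) (M * B)"
proof (rule eq_matI)
  fix i j assume "i < dim_row (hcat (M * A) (M * B))" "j < dim_col (hcat (M * A) (M * B))"
  then have "i < m" "j < k + l" using assms by (auto simp: hcat_def)
  then show "(M * hcat A B) $$ (i,j) = hcat (M * A) (M * B) $$ (i,j)"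
    using assms by (auto simp: hcat_def scalar_prod_def intro!: sum.cong)
qed (use assms in \<open>auto simp: hcat_def\<close>)

lemma hcat_mult_diag_sum:
  fixes A :: "'a :: comm_ring_1 mat"
  assumes "A \<in> carrier_mat n k" "B \<in> carrier_mat n l" "C \<in> carrier_mat k k'" "D \<in> carrier_mat l l'"
  shows "hcat A B * diag_sum C D = hcat (A * C) (B * D)"
  using assms unfolding hcat_def diag_sum_def
  by (subst mult_four_block_mat[of _ n k _ l _ 0 _ _ k' _ l']) auto

lemma diag_sum_mult:
  fixes A :: "'a :: comm_ring_1 mat"
  assumes "A \<in> carrier_mat k k" "B \<in> carrier_mat l l" "C \<in> carrier_mat k k'" "D \<in> carrier_mat l l'"
  shows "diag_sum A B * diag_sum C D = diag_sum (A * C) (B * D)"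
  using assms unfolding diag_sum_def
  by (subst mult_four_block_mat[of _ k k _ l _ l _ _ k' _ l']) auto

lemma hcat_mult_vec:
  fixes A :: "'a :: comm_ring_1 mat"
  assumes "A \<in> carrier_mat n k" "B \<in> carrier_mat n l" "x \<in> carrier_vec k" "y \<in> carrier_vec l"
  shows "hcat A B *\<^sub>v (x @\<^sub>v y) = A *\<^sub>v x + B *\<^sub>v y"
  using assms unfolding hcat_def
  by (subst four_block_mat_mult_vec[of _ n k _ l _ 0]) (auto simp: vec_eq_iff)

lemma poly_mat_diag_sum:
  fixes A :: "'a :: comm_ring_1 mat"
  assumes A: "A \<in> carrier_mat k k" and B: "B \<in> carrier_mat l l"
  shows "poly_mat p (diag_sum A B) = diag_sum (poly_mat p A) (poly_mat p B)"
proof (induction p)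
  case 0
  show ?case using A B by (simp add: poly_mat_0[of _ "k + l"] poly_mat_0[of _ k] poly_mat_0[of _ l] diag_sum_def)
next
  case (pCons a p)
  have "poly_mat (pCons a p) (diag_sum A B)
      = a \<cdot>\<^sub>m 1\<^sub>m (k + l) + diag_sum (A * poly_mat p A) (B * poly_mat p B)"
    using A B pCons.IH by (simp add: poly_mat_pCons[of _ "k + l"] diag_sum_mult[of _ k _ l _ k _ l])
  also have "\<dots> = diag_sum (poly_mat (pCons a p) A) (poly_mat (pCons a p) B)"
    unfolding poly_mat_pCons[OF A] poly_mat_pCons[OF B]
    using A B by (auto simp: mat_eq_iff diag_sum_def simp del: index_mult_mat(1))
  finally show ?case .
qed

lemma diag_sum_eq_0_iff:
  fixes A :: "'a :: zero mat"
  assumes "A \<in> carrier_mat k k" "B \<in> carrier_mat l l"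
  shows "diag_sum A B = 0\<^sub>m (k + l) (k + l) \<longleftrightarrow> A = 0\<^sub>m k k \<and> B = 0\<^sub>m l l"
proof -
  have "(0\<^sub>m (k + l) (k + l) :: 'a mat) = diag_sum (0\<^sub>m k k) (0\<^sub>m l l)" by (simp add: diag_sum_def)
  then show ?thesis
    using assms diag_sum_eq_iff[of A k B l "0\<^sub>m k k" "0\<^sub>m l l"] by simp
qed

section \<open>Injective matrices\<close>

text \<open>The columns of an injective \<open>n\<close> by \<open>k\<close> matrix form an ordered basis of a \<open>k\<close>-dimensional
  subspace. Working with such matrices instead of with subspaces turns choices of bases into
  objects that can be counted.\<close>

definition inj_mats :: "nat \<Rightarrow> nat \<Rightarrow> 'a :: field mat set" where
  "inj_mats n k = {B \<in> carrier_mat n k. \<forall>v \<in> carrier_vec k. B *\<^sub>v v = 0\<^sub>v n \<longrightarrow> v = 0\<^sub>v k}"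

definition GL :: "nat \<Rightarrow> 'a :: field mat set" where
  "GL n = {A \<in> carrier_mat n n. invertible_mat A}"

definition mat_im :: "'a :: field mat \<Rightarrow> 'a vec set" where
  "mat_im B = (\<lambda>v. B *\<^sub>v v) ` carrier_vec (dim_col B)"

lemma inj_mats_carrier [dest]: "B \<in> inj_mats n k \<Longrightarrow> B \<in> carrier_mat n k"
  by (simp add: inj_mats_def)

lemma GL_carrier [dest]: "P \<in> GL n \<Longrightarrow> P \<in> carrier_mat n n"
  by (simp add: GL_def)

lemma mult_mat_0_vec: "B \<in> carrier_mat n k \<Longrightarrow> B *\<^sub>v 0\<^sub>v k = 0\<^sub>v n"
  by (auto simp: vec_eq_iff)

lemma mult_mat_unit_vec: "(B :: 'a :: field mat) \<in> carrier_mat n k \<Longrightarrow> j < k \<Longrightarrow> B *\<^sub>v unit_vec k j = col B j"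
  by (auto simp: vec_eq_iff)

lemma inj_mats_vec_cancel:
  assumes B: "B \<in> inj_mats n k" and v: "v \<in> carrier_vec k" "w \<in> carrier_vec k"
    and eq: "B *\<^sub>v v = B *\<^sub>v w"
  shows "v = w"
proof -
  have Bc: "B \<in> carrier_mat n k" using B by auto
  have "B *\<^sub>v (v - w) = B *\<^sub>v v - B *\<^sub>v w"
    using Bc v by (rule mult_minus_distrib_mat_vec)
  also have "\<dots> = 0\<^sub>v n" using eq Bc v by (auto simp: vec_eq_iff)
  finally have "v - w = 0\<^sub>v k" using B v by (auto simp: inj_mats_def)
  then have "(v - w) $ i = 0" if "i < k" for i using that by simp
  then show "v = w" using v by (auto simp: vec_eq_iff)
qed

lemma mat_eq_colI:
  assumes "A \<in> carrier_mat n m" "B \<in> carrier_mat n m" "\<And>j. j < m \<Longrightarrow> col A j = col B j"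
  shows "A = B"
  by (rule mat_col_eqI) (use assms in auto)

lemma inj_mats_cancel:
  assumes B: "B \<in> inj_mats n k" and S: "S \<in> carrier_mat k m" and T: "T \<in> carrier_mat k m"
    and eq: "B * S = B * T"
  shows "S = T"
proof (rule mat_eq_colI[OF S T])
  fix j assume j: "j < m"
  have Bc: "B \<in> carrier_mat n k" using B by auto
  have e: "B *\<^sub>v col S j = B *\<^sub>v col T j"
    using arg_cong[OF eq, of "\<lambda>M. col M j"] j S T Bc by simp
  show "col S j = col T j"
    by (rule inj_mats_vec_cancel[OF B _ _ e]) (use S T in \<open>auto intro: carrier_vecI\<close>)
qed

lemma inj_mats_eq_0:
  assumes "B \<in> inj_mats n k" "S \<in> carrier_mat k m" "B * S = 0\<^sub>m n m"
  shows "S = 0\<^sub>m k m"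
  using assms inj_mats_cancel[OF assms(1,2), of "0\<^sub>m k m"] by (auto dest!: inj_mats_carrier)

lemma inj_mats_square: "inj_mats n n = GL n"
proof (intro Set.equalityI subsetI)
  fix A :: "'a mat" assume "A \<in> GL n"
  then obtain B where A: "A \<in> carrier_mat n n" and AB: "A * B = 1\<^sub>m n"
    and BA: "B * A = 1\<^sub>m (dim_row B)"
    by (auto simp: GL_def invertible_mat_def inverts_mat_def)
  have B: "B \<in> carrier_mat n n"
    using A arg_cong[OF AB, of dim_col] arg_cong[OF BA, of dim_col] by auto
  have "v = 0\<^sub>v n" if v: "v \<in> carrier_vec n" "A *\<^sub>v v = 0\<^sub>v n" for v
  proof -
    have "v = (B * A) *\<^sub>v v" using BA B v by simp
    also have "\<dots> = B *\<^sub>v (A *\<^sub>v v)" using A B v by (intro assoc_mult_mat_vec) auto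
    also have "\<dots> = 0\<^sub>v n" unfolding v(2) using B by (auto simp: vec_eq_iff)
    finally show ?thesis .
  qed
  then show "A \<in> inj_mats n n" using A by (auto simp: inj_mats_def)
next
  fix A :: "'a mat" assume "A \<in> inj_mats n n"
  then have A: "A \<in> carrier_mat n n" and "det A \<noteq> 0"
    by (auto simp: inj_mats_def det_0_iff_vec_prod_zero_field)
  then have "A \<in> Units (ring_mat TYPE('a) n ())" by (rule det_non_zero_imp_unit)
  then show "A \<in> GL n"
    using A by (auto simp: GL_def Units_def ring_mat_def invertible_mat_def inverts_mat_def)
qed

lemma GL_inverse:
  assumes "P \<in> GL n"
  obtains Q where "Q \<in> GL n" "P * Q = 1\<^sub>m n" "Q * P = 1\<^sub>m n"
proof -
  obtain Q where P: "P \<in> carrier_mat n n" and PQ: "P * Q = 1\<^sub>m n"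
    and QP: "Q * P = 1\<^sub>m (dim_row Q)"
    using assms by (auto simp: GL_def invertible_mat_def inverts_mat_def)
  have Q: "Q \<in> carrier_mat n n"
    using P arg_cong[OF PQ, of dim_col] arg_cong[OF QP, of dim_col] by auto
  then have "Q \<in> GL n"
    using P PQ QP by (auto simp: GL_def invertible_mat_def inverts_mat_def)
  then show ?thesis using that PQ QP Q by auto
qed

lemma inj_mats_le:
  fixes B :: "'a :: field mat"
  assumes B: "B \<in> inj_mats n k"
  shows "k \<le> n"
proof (rule ccontr)
  assume "\<not> k \<le> n"
  then have n: "n < k" by simp
  \<comment> \<open>Padding with zero rows gives a singular square matrix, whose kernel is that of \<open>B\<close>.\<close>
  define M where "M = mat k k (\<lambda>(i,j). if i < n then B $$ (i,j) else 0)"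
  have M: "M \<in> carrier_mat k k" by (simp add: M_def)
  have "transpose_mat M *\<^sub>v unit_vec k n = 0\<^sub>v k"
    using n M by (auto simp: M_def vec_eq_iff)
  moreover have "unit_vec k n \<noteq> (0\<^sub>v k :: 'a vec)"
    using n by (auto simp: vec_eq_iff)
  ultimately have "det (transpose_mat M) = 0"
    using M by (subst det_0_iff_vec_prod_zero_field[of _ k]) (auto intro!: exI[of _ "unit_vec k n"])
  then have "det M = 0" using M by (simp add: det_transpose)
  then obtain v where v: "v \<in> carrier_vec k" "v \<noteq> 0\<^sub>v k" "M *\<^sub>v v = 0\<^sub>v k"
    using M by (subst (asm) det_0_iff_vec_prod_zero_field[of _ k]) auto
  have "(B *\<^sub>v v) $ i = (M *\<^sub>v v) $ i" if "i < n" for i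
    using that n B v(1) by (auto simp: M_def scalar_prod_def dest!: inj_mats_carrier)
  then have "B *\<^sub>v v = 0\<^sub>v n" using v(3) n B by (auto simp: vec_eq_iff dest!: inj_mats_carrier)
  then show False using B v by (auto simp: inj_mats_def)
qed

lemma inj_mats_mult:
  assumes A: "A \<in> inj_mats n k" and B: "B \<in> inj_mats k l"
  shows "A * B \<in> inj_mats n l"
proof -
  have c: "A \<in> carrier_mat n k" "B \<in> carrier_mat k l" using A B by auto
  have "v = 0\<^sub>v l" if v: "v \<in> carrier_vec l" "(A * B) *\<^sub>v v = 0\<^sub>v n" for v
  proof -
    have "A *\<^sub>v (B *\<^sub>v v) = 0\<^sub>v n" using c v by simp
    then have "B *\<^sub>v v = 0\<^sub>v k" using A c v by (auto simp: inj_mats_def)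
    then show ?thesis using B v by (auto simp: inj_mats_def)
  qed
  then show ?thesis using c by (auto simp: inj_mats_def)
qed

lemma inj_mats_mult_right:
  assumes A: "A \<in> carrier_mat n k" and B: "B \<in> carrier_mat k l" and AB: "A * B \<in> inj_mats n l"
  shows "B \<in> inj_mats k l"
proof -
  have "v = 0\<^sub>v l" if v: "v \<in> carrier_vec l" "B *\<^sub>v v = 0\<^sub>v k" for v
  proof -
    have "(A * B) *\<^sub>v v = A *\<^sub>v (B *\<^sub>v v)" using A B v by simp
    also have "\<dots> = 0\<^sub>v n" unfolding v(2) using A by (auto simp: vec_eq_iff)
    finally show ?thesis using AB v by (auto simp: inj_mats_def)
  qed
  then show ?thesis using B by (auto simp: inj_mats_def)
qed

lemma inj_mats_hcatI:
  assumes A: "A \<in> inj_mats n k" and B: "B \<in> carrier_mat n l"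
    and disj: "\<And>x y. x \<in> carrier_vec k \<Longrightarrow> y \<in> carrier_vec l \<Longrightarrow> A *\<^sub>v x + B *\<^sub>v y = 0\<^sub>v n \<Longrightarrow> y = 0\<^sub>v l"
  shows "hcat A B \<in> inj_mats n (k + l)"
proof -
  have Ac: "A \<in> carrier_mat n k" using A by auto
  have "x @\<^sub>v y = 0\<^sub>v (k + l)"
    if "x \<in> carrier_vec k" "y \<in> carrier_vec l" "hcat A B *\<^sub>v (x @\<^sub>v y) = 0\<^sub>v n" for x y
  proof -
    have e: "A *\<^sub>v x + B *\<^sub>v y = 0\<^sub>v n" using that Ac B by (simp add: hcat_mult_vec)
    then have y: "y = 0\<^sub>v l" using disj that by blast
    then have "A *\<^sub>v x = 0\<^sub>v n" using e that(1) Ac unfolding y mult_mat_0_vec[OF B]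
      by simp
    then have "x = 0\<^sub>v k" using A that by (auto simp: inj_mats_def)
    then show ?thesis using y by auto
  qed
  then have "\<forall>z\<in>carrier_vec (k + l). hcat A B *\<^sub>v z = 0\<^sub>v n \<longrightarrow> z = 0\<^sub>v (k + l)"
    by (subst all_vec_append) blast
  then show ?thesis using hcat_carrier[OF Ac B] by (simp add: inj_mats_def)
qed

lemma inj_mats_hcatD:
  assumes AB: "hcat A B \<in> inj_mats n (k + l)" and A: "A \<in> carrier_mat n k" and B: "B \<in> carrier_mat n l"
    and xy: "x \<in> carrier_vec k" "y \<in> carrier_vec l" "A *\<^sub>v x + B *\<^sub>v y = 0\<^sub>v n"
  shows "x = 0\<^sub>v k" "y = 0\<^sub>v l"
proof -
  have "hcat A B *\<^sub>v (x @\<^sub>v y) = 0\<^sub>v n" using A B xy by (simp add: hcat_mult_vec)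
  then have "x @\<^sub>v y = 0\<^sub>v (k + l)" using AB xy by (auto simp: inj_mats_def)
  also have "\<dots> = 0\<^sub>v k @\<^sub>v 0\<^sub>v l" by auto
  finally show "x = 0\<^sub>v k" "y = 0\<^sub>v l" using xy by (simp_all add: append_vec_eq[of _ k])
qed

lemma inj_mats_hcat_left:
  assumes AB: "hcat A B \<in> inj_mats n (k + l)" and A: "A \<in> carrier_mat n k" and B: "B \<in> carrier_mat n l"
  shows "A \<in> inj_mats n k"
proof -
  have "x = 0\<^sub>v k" if "x \<in> carrier_vec k" "A *\<^sub>v x = 0\<^sub>v n" for x
    by (rule inj_mats_hcatD(1)[OF AB A B, of _ "0\<^sub>v l"]) (use that A B in \<open>simp_all add: mult_mat_0_vec\<close>)
  then show ?thesis using A by (auto simp: inj_mats_def)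
qed

lemma diag_sum_mult_vec:
  fixes A :: "'a :: comm_ring_1 mat"
  assumes "A \<in> carrier_mat n k" "B \<in> carrier_mat m l" "x \<in> carrier_vec k" "y \<in> carrier_vec l"
  shows "diag_sum A B *\<^sub>v (x @\<^sub>v y) = (A *\<^sub>v x) @\<^sub>v (B *\<^sub>v y)"
  using assms unfolding diag_sum_def
  by (subst four_block_mat_mult_vec[of _ n k _ l _ m]) (auto simp: vec_eq_iff)

lemma inj_mats_diag_sum:
  assumes A: "A \<in> carrier_mat n k" and B: "B \<in> carrier_mat m l"
  shows "diag_sum A B \<in> inj_mats (n + m) (k + l) \<longleftrightarrow> A \<in> inj_mats n k \<and> B \<in> inj_mats m l"
proof -
  have 0: "0\<^sub>v (i + j) = 0\<^sub>v i @\<^sub>v (0\<^sub>v j :: 'a vec)" for i j by auto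
  have "diag_sum A B \<in> inj_mats (n + m) (k + l) \<longleftrightarrow>
      (\<forall>x\<in>carrier_vec k. \<forall>y\<in>carrier_vec l. A *\<^sub>v x = 0\<^sub>v n \<and> B *\<^sub>v y = 0\<^sub>v m \<longrightarrow> x = 0\<^sub>v k \<and> y = 0\<^sub>v l)"
    using A B unfolding inj_mats_def mem_Collect_eq all_vec_append 0
    by (auto simp: diag_sum_mult_vec[OF A B] append_vec_eq[of _ n] append_vec_eq[of _ k])
  also have "\<dots> \<longleftrightarrow> A \<in> inj_mats n k \<and> B \<in> inj_mats m l"
  proof -
    have "A *\<^sub>v 0\<^sub>v k = 0\<^sub>v n" "B *\<^sub>v 0\<^sub>v l = 0\<^sub>v m" using A B by (simp_all add: mult_mat_0_vec)
    then show ?thesis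
      using A B unfolding inj_mats_def by (auto intro: zero_carrier_vec)
  qed
  finally show ?thesis .
qed

text \<open>Used to restrict an operator to an invariant subspace: if the columns of \<open>K\<close> span it and
  \<open>M = A * K\<close>, then the factor is the matrix of the restriction.\<close>

lemma mat_factor:
  assumes K: "K \<in> carrier_mat n k" and M: "M \<in> carrier_mat n m"
    and cols: "\<And>j. j < m \<Longrightarrow> col M j \<in> mat_im K"
  obtains S where "S \<in> carrier_mat k m" "M = K * S"
proof -
  have "\<forall>j. \<exists>x. j < m \<longrightarrow> x \<in> carrier_vec k \<and> col M j = K *\<^sub>v x"
    using cols K by (auto simp: mat_im_def)
  then obtain x where x: "\<And>j. j < m \<Longrightarrow> x j \<in> carrier_vec k \<and> col M j = K *\<^sub>v x j"
    by metis
  define S where "S = mat k m (\<lambda>(i,j). x j $ i)"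
  have S: "S \<in> carrier_mat k m" by (simp add: S_def)
  have "M = K * S"
  proof (rule mat_eq_colI[OF M])
    fix j assume j: "j < m"
    have "x j \<in> carrier_vec k" using x[OF j] by simp
    then have "col S j = x j" using j by (auto simp: S_def)
    then show "col M j = col (K * S) j" using j x K S by simp
  qed (use K S in auto)
  then show ?thesis using that S by blast
qed

text \<open>A matrix with the largest possible number of independent columns in \<open>W\<close> spans \<open>W\<close>, since a
  vector of \<open>W\<close> outside of its image could be appended as a further column.\<close>

lemma subspace_basis:
  fixes W :: "'a :: field vec set"
  assumes W: "W \<subseteq> carrier_vec n" "0\<^sub>v n \<in> W"
    and add: "\<And>v w. v \<in> W \<Longrightarrow> w \<in> W \<Longrightarrow> v + w \<in> W"
    and smult: "\<And>c v. v \<in> W \<Longrightarrow> c \<cdot>\<^sub>v v \<in> W"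
  obtains k B where "B \<in> inj_mats n k" "mat_im B = W"
proof -
  let ?P = "\<lambda>k. \<exists>B \<in> inj_mats n k. mat_im B \<subseteq> W"
  have "mat n 0 (\<lambda>_. 0) \<in> inj_mats n 0" by (auto simp: inj_mats_def)
  moreover have "mat n 0 (\<lambda>_. 0) *\<^sub>v v = 0\<^sub>v n" if "v \<in> carrier_vec 0" for v :: "'a vec"
    using that by (auto simp: scalar_prod_def)
  then have "mat_im (mat n 0 (\<lambda>_. 0)) \<subseteq> W" using W by (auto simp: mat_im_def)
  ultimately have P0: "?P 0" by blast
  define k where "k = (GREATEST k. ?P k)"
  have bound: "\<And>k. ?P k \<Longrightarrow> k \<le> n" using inj_mats_le by blast
  have "?P k" unfolding k_def by (rule GreatestI_nat[where P = ?P and b = n]) (use P0 bound in auto)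
  then obtain B where B: "B \<in> inj_mats n k" and sub: "mat_im B \<subseteq> W" by blast
  have Bc: "B \<in> carrier_mat n k" using B by auto
  have "w \<in> mat_im B" if w: "w \<in> W" for w
  proof (rule ccontr)
    assume notin: "w \<notin> mat_im B"
    have wc: "w \<in> carrier_vec n" using w W by auto
    define C where "C = mat n 1 (\<lambda>(i,_). w $ i)"
    have C: "C \<in> carrier_mat n 1" by (simp add: C_def)
    have Cy: "C *\<^sub>v y = y $ 0 \<cdot>\<^sub>v w" if "y \<in> carrier_vec 1" for y
      using that wc by (auto simp: C_def vec_eq_iff scalar_prod_def)
    have "hcat B C \<in> inj_mats n (k + 1)"
    proof (rule inj_mats_hcatI[OF B C])
      fix x y :: "'a vec"
      assume x: "x \<in> carrier_vec k" and y: "y \<in> carrier_vec 1" and e: "B *\<^sub>v x + C *\<^sub>v y = 0\<^sub>v n"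
      have "y $ 0 = 0"
      proof (rule ccontr)
        assume nz: "y $ 0 \<noteq> 0"
        have "B *\<^sub>v ((- inverse (y $ 0)) \<cdot>\<^sub>v x) = (- inverse (y $ 0)) \<cdot>\<^sub>v (B *\<^sub>v x)"
          by (rule mult_mat_vec[OF Bc x])
        also have "\<dots> = w"
        proof (rule eq_vecI)
          fix i assume i: "i < dim_vec w"
          have "(B *\<^sub>v x + C *\<^sub>v y) $ i = 0" using e i wc by simp
          then have "(B *\<^sub>v x) $ i = - (y $ 0 * w $ i)"
            using i Bc wc y C by (simp add: Cy eq_neg_iff_add_eq_0)
          then show "((- inverse (y $ 0)) \<cdot>\<^sub>v (B *\<^sub>v x)) $ i = w $ i"
            using i Bc wc nz by (simp del: index_mult_mat_vec)
        qed (use wc Bc in auto)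
        finally have "w = B *\<^sub>v ((- inverse (y $ 0)) \<cdot>\<^sub>v x)" by simp
        moreover have "(- inverse (y $ 0)) \<cdot>\<^sub>v x \<in> carrier_vec (dim_col B)" using Bc x by simp
        ultimately have "w \<in> mat_im B" unfolding mat_im_def by (rule image_eqI)
        then show False using notin by simp
      qed
      then show "y = 0\<^sub>v 1" using y by (auto simp: vec_eq_iff)
    qed
    moreover have "mat_im (hcat B C) \<subseteq> W"
    proof -
      have "hcat B C *\<^sub>v (x @\<^sub>v y) \<in> W" if "x \<in> carrier_vec k" "y \<in> carrier_vec 1" for x y
      proof -
        have "B *\<^sub>v x \<in> W" using sub that Bc by (auto simp: mat_im_def)
        then show ?thesis using that by (simp add: hcat_mult_vec[OF Bc C] Cy add smult w)
      qed
      moreover have "dim_col (hcat B C) = k + 1" using Bc C by (simp add: hcat_def)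
      ultimately show ?thesis unfolding mat_im_def
        using all_vec_append[of k 1 "\<lambda>v. hcat B C *\<^sub>v v \<in> W"] by auto
    qed
    ultimately have "?P (k + 1)" by blast
    then have "k + 1 \<le> k" unfolding k_def by (intro Greatest_le_nat[where P = ?P and b = n]) (use bound in auto)
    then show False by simp
  qed
  then show ?thesis using that[OF B] sub by blast
qed

section \<open>Splitting along coprime factors\<close>

text \<open>Up to the choice of a basis these matrices are the modules over \<open>K[X]/(f)\<close> of dimension
  \<open>n\<close> over the base field.\<close>

definition annihilated :: "'a :: field poly \<Rightarrow> nat \<Rightarrow> 'a mat set" where
  "annihilated f n = {A \<in> carrier_mat n n. poly_mat f A = 0\<^sub>m n n}"

text \<open>The Bezout form of coprimality is used since it evaluates directly to an identity between
  matrices.\<close>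

definition comaximal :: "'a :: comm_ring_1 \<Rightarrow> 'a \<Rightarrow> bool" where
  "comaximal f g \<longleftrightarrow> (\<exists>u v. u * f + v * g = 1)"

lemma comaximal_commute: "comaximal f g \<longleftrightarrow> comaximal g f"
  by (metis add.commute comaximal_def)

lemma annihilated_carrier [dest]: "A \<in> annihilated f n \<Longrightarrow> A \<in> carrier_mat n n"
  by (simp add: annihilated_def)

lemma annihilatedD: "A \<in> annihilated f n \<Longrightarrow> poly_mat f A = 0\<^sub>m n n"
  by (simp add: annihilated_def)

lemma annihilated_dvd:
  assumes "A \<in> annihilated f n" "f dvd g"
  shows "A \<in> annihilated g n"
  using poly_mat_dvd[OF annihilated_carrier[OF assms(1)] assms(2) annihilatedD[OF assms(1)]]
    annihilated_carrier[OF assms(1)] by (simp add: annihilated_def)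

text \<open>The matrix \<open>B\<close> describes the restriction of \<open>A\<close> to an invariant subspace.\<close>

lemma annihilated_pullback:
  assumes P: "P \<in> inj_mats n k" and A: "A \<in> annihilated f n" and B: "B \<in> carrier_mat k k"
    and eq: "A * P = P * B"
  shows "B \<in> annihilated f k"
proof -
  have c: "A \<in> carrier_mat n n" "P \<in> carrier_mat n k" using A P by auto
  have "P * poly_mat f B = poly_mat f A * P"
    using poly_mat_intertwine[OF c B eq] by simp
  also have "\<dots> = 0\<^sub>m n k" using A c by (simp add: annihilated_def)
  finally have "poly_mat f B = 0\<^sub>m k k" 
    using inj_mats_eq_0[OF P poly_mat_carrier[OF B]] by simp
  then show ?thesis using B by (simp add: annihilated_def)
qed

lemma annihilated_pushforward:
  assumes P: "P \<in> GL n" and A: "A \<in> carrier_mat n n" and B: "B \<in> annihilated f n"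
    and eq: "A * P = P * B"
  shows "A \<in> annihilated f n"
proof -
  obtain Q where Q: "Q \<in> GL n" "P * Q = 1\<^sub>m n" "Q * P = 1\<^sub>m n" using GL_inverse[OF P] .
  have c: "P \<in> carrier_mat n n" "Q \<in> carrier_mat n n" "B \<in> carrier_mat n n" using P Q B by auto
  have "Q * A = Q * A * (P * Q)" using A c Q by simp
  also have "\<dots> = Q * (A * P) * Q" using A c by (simp add: assoc_mult_mat[of _ n n _ n _ n])
  also have "\<dots> = Q * P * B * Q" unfolding eq using c by (simp add: assoc_mult_mat[of _ n n _ n _ n])
  also have "\<dots> = B * Q" using c Q by simp
  finally show ?thesis
    using annihilated_pullback[of Q n n B f A] Q B A by (simp add: inj_mats_square)
qed

text \<open>There are no nonzero homomorphisms between modules annihilated by coprime polynomials: \<open>g\<close>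
  kills the source and acts invertibly on the target. This is what makes the decomposition into
  coprime parts unique.\<close>

lemma intertwiner_eq_0:
  assumes fg: "comaximal f g" and A: "A \<in> annihilated f k" and B: "B \<in> annihilated g l"
    and S: "S \<in> carrier_mat k l" and eq: "A * S = S * B"
  shows "S = 0\<^sub>m k l"
proof -
  obtain u v where uv: "u * f + v * g = 1" using fg by (auto simp: comaximal_def)
  have c: "A \<in> carrier_mat k k" "B \<in> carrier_mat l l" using A B by auto
  have "S = poly_mat (u * f + v * g) A * S" using uv c S by (simp add: poly_mat_1)
  also have "poly_mat (u * f + v * g) A = poly_mat u A * poly_mat f A + poly_mat v A * poly_mat g A"
    using c by (simp add: poly_mat_add poly_mat_mult)
  also have "\<dots> = poly_mat v A * poly_mat g A"
    using A c by (simp add: annihilated_def right_mult_zero_mat[OF poly_mat_carrier]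
        left_add_zero_mat[OF mult_carrier_mat[OF poly_mat_carrier poly_mat_carrier]])
  also have "poly_mat v A * poly_mat g A * S = poly_mat v A * (poly_mat g A * S)"
    using c S by (intro assoc_mult_mat[of _ k k _ k _ l]) auto
  also have "poly_mat g A * S = S * poly_mat g B" by (rule poly_mat_intertwine[OF c(1) S c(2) eq])
  also have "\<dots> = 0\<^sub>m k l" using B S by (simp add: annihilated_def)
  also have "poly_mat v A * 0\<^sub>m k l = 0\<^sub>m k l" using c by (simp add: right_mult_zero_mat[OF poly_mat_carrier])
  finally show ?thesis .
qed

lemma diag_sum_annihilated:
  assumes A: "A \<in> annihilated f k" and B: "B \<in> annihilated f l"
  shows "diag_sum A B \<in> annihilated f (k + l)"
proof -
  have c: "A \<in> carrier_mat k k" "B \<in> carrier_mat l l" using A B by auto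
  then show ?thesis
    using diag_sum_carrier[OF c] annihilatedD[OF A] annihilatedD[OF B]
    by (simp add: annihilated_def poly_mat_diag_sum diag_sum_eq_0_iff)
qed

lemma poly_mat_mult_apply:
  assumes A: "A \<in> carrier_mat n n" and w: "w \<in> carrier_vec n"
  shows "poly_mat (p * q) A *\<^sub>v w = poly_mat p A *\<^sub>v (poly_mat q A *\<^sub>v w)"
  using A w by (simp add: poly_mat_mult assoc_mult_mat_vec[OF poly_mat_carrier poly_mat_carrier])

text \<open>The kernel of \<open>f(A)\<close> is \<open>A\<close>-invariant because \<open>A\<close> commutes with \<open>f(A)\<close>; the matrix \<open>B\<close> is
  the restriction of \<open>A\<close> to it.\<close>

lemma poly_mat_kernel_basis:
  assumes A: "A \<in> carrier_mat n n"
  obtains k K B where "K \<in> inj_mats n k" "mat_im K = {v \<in> carrier_vec n. poly_mat f A *\<^sub>v v = 0\<^sub>v n}"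
    "B \<in> annihilated f k" "A * K = K * B"
proof -
  let ?W = "{v \<in> carrier_vec n. poly_mat f A *\<^sub>v v = 0\<^sub>v n}"
  note F = poly_mat_carrier[OF A, of f]
  obtain k K where K: "K \<in> inj_mats n k" and im: "mat_im K = ?W"
  proof (rule subspace_basis[of ?W n])
    show "0\<^sub>v n \<in> ?W" by (simp add: mult_mat_0_vec[OF F])
    show "v + w \<in> ?W" if "v \<in> ?W" "w \<in> ?W" for v w
      using that by (simp add: mult_add_distrib_mat_vec[OF F])
    show "c \<cdot>\<^sub>v v \<in> ?W" if "v \<in> ?W" for c v
    proof -
      have "poly_mat f A *\<^sub>v (c \<cdot>\<^sub>v v) = c \<cdot>\<^sub>v (poly_mat f A *\<^sub>v v)"
        using that by (intro mult_mat_vec[OF F]) auto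
      then show ?thesis using that by auto
    qed
  qed auto
  have Kc: "K \<in> carrier_mat n k" using K by auto
  have fK: "poly_mat f A * K = 0\<^sub>m n k"
  proof (rule mat_eq_colI)
    fix j assume j: "j < k"
    have "col K j = K *\<^sub>v unit_vec k j" using Kc j by (simp add: mult_mat_unit_vec)
    then have "col K j \<in> ?W" unfolding im[symmetric] mat_im_def using Kc by auto
    then show "col (poly_mat f A * K) j = col (0\<^sub>m n k) j"
      using F Kc j by (simp add: col_mult2[OF F Kc])
  qed (use mult_carrier_mat[OF F Kc] in auto)
  have "poly_mat f A * (A * K) = 0\<^sub>m n k"
  proof -
    have "poly_mat f A * (A * K) = poly_mat f A * A * K"
      using F A Kc by (intro assoc_mult_mat[symmetric]) auto
    also have "poly_mat f A * A = A * poly_mat f A" by (rule poly_mat_intertwine[OF A A A refl])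
    also have "\<dots> * K = A * (poly_mat f A * K)"
      using F A Kc by (intro assoc_mult_mat) auto
    finally show ?thesis using fK A by simp
  qed
  then have "poly_mat f A *\<^sub>v col (A * K) j = 0\<^sub>v n" if "j < k" for j
    using that col_mult2[OF F mult_carrier_mat[OF A Kc] that] by simp
  then have "col (A * K) j \<in> mat_im K" if "j < k" for j
    unfolding im using that A Kc by (auto intro: carrier_vecI)
  then obtain B where B: "B \<in> carrier_mat k k" "A * K = K * B"
    using mat_factor[OF Kc mult_carrier_mat[OF A Kc]] by blast
  have "K * poly_mat f B = 0\<^sub>m n k" using poly_mat_intertwine[OF A Kc B] fK by simp
  then have "B \<in> annihilated f k"
    using inj_mats_eq_0[OF K poly_mat_carrier[OF B(1)]] B(1) by (simp add: annihilated_def)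
  then show ?thesis using that K im B by blast
qed

lemma GL_I_surj:
  assumes P: "P \<in> inj_mats n m" and surj: "carrier_vec n \<subseteq> mat_im P"
  shows "m = n" "P \<in> GL n"
proof -
  have Pc: "P \<in> carrier_mat n m" using P by auto
  obtain Q where Q: "Q \<in> carrier_mat m n" "1\<^sub>m n = P * Q"
    using mat_factor[OF Pc one_carrier_mat[of n]] surj by (metis col_one subsetD unit_vec_carrier)
  have "1\<^sub>m n \<in> inj_mats n n" by (auto simp: inj_mats_def)
  then have "Q \<in> inj_mats m n" by (intro inj_mats_mult_right[OF Pc Q(1)]) (simp add: Q(2)[symmetric])
  then show "m = n" using inj_mats_le P by (metis le_antisym)
  then show "P \<in> GL n" using P by (simp add: inj_mats_square)
qed

text \<open>The space is the direct sum of the kernels of \<open>f(A)\<close> and \<open>g(A)\<close>: if \<open>u f + v g = 1\<close> then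
  \<open>w = (u f)(A) w + (v g)(A) w\<close>, where the first summand is killed by \<open>g(A)\<close> and the second one
  by \<open>f(A)\<close>. Concatenating bases of the two kernels gives \<open>P\<close>. This holds over any field and is
  used both for counting over the finite field and for diagonalization over its algebraic
  closure.\<close>

lemma coprime_splitting:
  assumes fg: "comaximal f g" and A: "A \<in> annihilated (f * g) n"
  obtains k l P A\<^sub>1 A\<^sub>2 where "k + l = n" "P \<in> GL n" "A\<^sub>1 \<in> annihilated f k" "A\<^sub>2 \<in> annihilated g l"
    "A * P = P * diag_sum A\<^sub>1 A\<^sub>2"
proof -
  have Ac: "A \<in> carrier_mat n n" using A by auto
  note F = poly_mat_carrier[OF Ac, of f] and G = poly_mat_carrier[OF Ac, of g]
  obtain u v where uv: "u * f + v * g = 1" using fg by (auto simp: comaximal_def)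
  obtain k K B where K: "K \<in> inj_mats n k" "mat_im K = {v \<in> carrier_vec n. poly_mat f A *\<^sub>v v = 0\<^sub>v n}"
    "B \<in> annihilated f k" "A * K = K * B" using poly_mat_kernel_basis[OF Ac] .
  obtain l L C where L: "L \<in> inj_mats n l" "mat_im L = {v \<in> carrier_vec n. poly_mat g A *\<^sub>v v = 0\<^sub>v n}"
    "C \<in> annihilated g l" "A * L = L * C" using poly_mat_kernel_basis[OF Ac] .
  have c: "K \<in> carrier_mat n k" "L \<in> carrier_mat n l" "B \<in> carrier_mat k k" "C \<in> carrier_mat l l"
    using K L by auto
  have split: "w = poly_mat (u * f) A *\<^sub>v w + poly_mat (v * g) A *\<^sub>v w" if "w \<in> carrier_vec n" for w
  proof -
    have "w = poly_mat (u * f + v * g) A *\<^sub>v w" using that Ac by (simp add: uv poly_mat_1)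
    then show ?thesis
      using that Ac by (simp add: poly_mat_add add_mult_distrib_mat_vec[OF poly_mat_carrier poly_mat_carrier])
  qed
  have killed: "poly_mat (p * h) A *\<^sub>v w = 0\<^sub>v n" if "w \<in> carrier_vec n" "poly_mat h A *\<^sub>v w = 0\<^sub>v n" for p h w
    using that Ac
    by (simp add: poly_mat_mult_apply[of _ n] mult_mat_0_vec[OF poly_mat_carrier])
  have P: "hcat K L \<in> inj_mats n (k + l)"
  proof (rule inj_mats_hcatI[OF K(1) c(2)])
    fix x y assume x: "x \<in> carrier_vec k" and y: "y \<in> carrier_vec l" and e: "K *\<^sub>v x + L *\<^sub>v y = 0\<^sub>v n"
    have Kx: "K *\<^sub>v x \<in> carrier_vec n" "poly_mat f A *\<^sub>v (K *\<^sub>v x) = 0\<^sub>v n"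
      using K(2) x c by (auto simp: mat_im_def)
    have Ly: "L *\<^sub>v y \<in> carrier_vec n" "poly_mat g A *\<^sub>v (L *\<^sub>v y) = 0\<^sub>v n"
      using L(2) y c by (auto simp: mat_im_def)
    have "poly_mat f A *\<^sub>v (L *\<^sub>v y) = poly_mat f A *\<^sub>v (K *\<^sub>v x) + poly_mat f A *\<^sub>v (L *\<^sub>v y)"
      using Kx(2) mult_mat_vec_carrier[OF F Ly(1)] by simp
    also have "\<dots> = 0\<^sub>v n" using e mult_add_distrib_mat_vec[OF F Kx(1) Ly(1)] 
      by (simp add: mult_mat_0_vec[OF F])
    finally have "L *\<^sub>v y = 0\<^sub>v n + 0\<^sub>v n"
      using split[OF Ly(1)] killed[OF Ly(1)] Ly(2) by metis
    then have "L *\<^sub>v y = 0\<^sub>v n" by simp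
    then show "y = 0\<^sub>v l" using L(1) y by (auto simp: inj_mats_def)
  qed
  have "w \<in> mat_im (hcat K L)" if w: "w \<in> carrier_vec n" for w
  proof -
    have cv: "poly_mat h A *\<^sub>v w \<in> carrier_vec n" for h
      using mult_mat_vec_carrier[OF poly_mat_carrier[OF Ac] w] .
    have 0: "poly_mat (f * g * h) A *\<^sub>v w = 0\<^sub>v n" for h
    proof -
      have "poly_mat (f * g * h) A = 0\<^sub>m n n"
        by (rule annihilatedD[OF annihilated_dvd[OF A dvd_triv_left]])
      then show ?thesis using w by (simp add: vec_eq_iff)
    qed
    have "poly_mat g A *\<^sub>v (poly_mat (u * f) A *\<^sub>v w) = poly_mat (g * (u * f)) A *\<^sub>v w"
      by (rule poly_mat_mult_apply[OF Ac w, symmetric])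
    also have "g * (u * f) = f * g * u" by (simp add: mult_ac)
    finally have "poly_mat (u * f) A *\<^sub>v w \<in> mat_im L" using 0 cv by (simp add: L(2))
    then obtain y where y: "y \<in> carrier_vec l" "poly_mat (u * f) A *\<^sub>v w = L *\<^sub>v y"
      using c by (auto simp: mat_im_def)
    have "poly_mat f A *\<^sub>v (poly_mat (v * g) A *\<^sub>v w) = poly_mat (f * (v * g)) A *\<^sub>v w"
      by (rule poly_mat_mult_apply[OF Ac w, symmetric])
    also have "f * (v * g) = f * g * v" by (simp add: mult_ac)
    finally have "poly_mat (v * g) A *\<^sub>v w \<in> mat_im K" using 0 cv by (simp add: K(2))
    then obtain x where x: "x \<in> carrier_vec k" "poly_mat (v * g) A *\<^sub>v w = K *\<^sub>v x"
      using c by (auto simp: mat_im_def)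
    have "w = L *\<^sub>v y + K *\<^sub>v x" using split[OF w] x y by simp
    also have "\<dots> = K *\<^sub>v x + L *\<^sub>v y"
      using c x y by (intro comm_add_vec[of _ n]) auto
    also have "\<dots> = hcat K L *\<^sub>v (x @\<^sub>v y)" using c x y by (simp add: hcat_mult_vec)
    finally show ?thesis
      using x y hcat_carrier[OF c(1,2)] unfolding mat_im_def by (intro image_eqI[of _ _ "x @\<^sub>v y"]) auto
  qed
  then have "k + l = n" "hcat K L \<in> GL n" using GL_I_surj[OF P] by auto
  moreover have "A * hcat K L = hcat K L * diag_sum B C"
    using c Ac K(4) L(4) by (simp add: mult_hcat hcat_mult_diag_sum)
  ultimately show ?thesis using that K(3) L(3) by blast
qed

section \<open>Multiplicativity over coprime factors\<close>

text \<open>For invertible \<open>P\<close> and coprime \<open>f\<close> and \<open>g\<close> this says that the first \<open>k\<close> columns of \<open>P\<close>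
  form a basis of the kernel of \<open>f(A)\<close> and the remaining \<open>l\<close> columns a basis of the kernel of
  \<open>g(A)\<close>.\<close>

definition adapted :: "'a :: field poly \<Rightarrow> 'a poly \<Rightarrow> nat \<Rightarrow> nat \<Rightarrow> 'a mat \<Rightarrow> 'a mat \<Rightarrow> bool" where
  "adapted f g k l A P \<longleftrightarrow>
     (\<exists>B \<in> annihilated f k. \<exists>C \<in> annihilated g l. A * P = P * diag_sum B C)"

lemma four_block_mat_eqD:
  assumes "four_block_mat A B C D = four_block_mat A' B' C' D'"
    and "A \<in> carrier_mat k k'" "B \<in> carrier_mat k l'" "C \<in> carrier_mat l k'" "D \<in> carrier_mat l l'"
    and "A' \<in> carrier_mat k k'" "B' \<in> carrier_mat k l'" "C' \<in> carrier_mat l k'" "D' \<in> carrier_mat l l'"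
  shows "B = B'" "C = C'"
proof -
  have "B $$ (i,j) = B' $$ (i,j)" if "i < k" "j < l'" for i j
    using arg_cong[OF assms(1), of "\<lambda>M. M $$ (i,k' + j)"] that assms(2-) by simp
  moreover have "C $$ (i,j) = C' $$ (i,j)" if "i < l" "j < k'" for i j
    using arg_cong[OF assms(1), of "\<lambda>M. M $$ (k + i,j)"] that assms(2-) by simp
  ultimately show "B = B'" "C = C'" using assms(2-) by (auto simp: mat_eq_iff)
qed

text \<open>The off-diagonal blocks of \<open>R\<close> intertwine matrices annihilated by coprime polynomials, so
  they vanish.\<close>

lemma intertwiner_block_diagonal:
  assumes fg: "comaximal f g"
    and B: "B \<in> annihilated f k" and C: "C \<in> annihilated g l"
    and B': "B' \<in> annihilated f k'" and C': "C' \<in> annihilated g l'"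
    and R: "R \<in> carrier_mat (k + l) (k' + l')"
    and eq: "diag_sum B C * R = R * diag_sum B' C'"
  obtains S T where "S \<in> carrier_mat k k'" "T \<in> carrier_mat l l'" "R = diag_sum S T"
proof -
  obtain R1 R2 R3 R4 where "split_block R k k' = (R1, R2, R3, R4)" by (metis surj_pair)
  from split_block[OF this] R
  have R1: "R1 \<in> carrier_mat k k'" and R2: "R2 \<in> carrier_mat k l'"
    and R3: "R3 \<in> carrier_mat l k'" and R4: "R4 \<in> carrier_mat l l'"
    and R_eq: "R = four_block_mat R1 R2 R3 R4" by auto
  have c: "B \<in> carrier_mat k k" "C \<in> carrier_mat l l" "B' \<in> carrier_mat k' k'" "C' \<in> carrier_mat l' l'"
    using B C B' C' by auto
  have 1: "diag_sum B C * R = four_block_mat (B * R1) (B * R2) (C * R3) (C * R4)"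
    unfolding R_eq diag_sum_def using c R1 R2 R3 R4
    by (subst mult_four_block_mat[of _ k k _ l _ l _ _ k' _ l'])
      (auto simp: left_mult_zero_mat[of _ l] left_mult_zero_mat[of _ k]
         left_add_zero_mat[OF mult_carrier_mat] right_add_zero_mat[OF mult_carrier_mat])
  have 2: "R * diag_sum B' C' = four_block_mat (R1 * B') (R2 * C') (R3 * B') (R4 * C')"
    unfolding R_eq diag_sum_def using c R1 R2 R3 R4
    by (subst mult_four_block_mat[of _ k k' _ l' _ l _ _ k' _ l'])
      (auto simp: right_mult_zero_mat 
         left_add_zero_mat[OF mult_carrier_mat] right_add_zero_mat[OF mult_carrier_mat])
  have "B * R2 = R2 * C'" "C * R3 = R3 * B'"
    by (rule four_block_mat_eqD[OF eq[unfolded 1 2], of k k' l' l]; use c R1 R2 R3 R4 in auto)+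
  then have "R2 = 0\<^sub>m k l'" "R3 = 0\<^sub>m l k'"
    using intertwiner_eq_0[OF fg B C' R2] intertwiner_eq_0[OF _ C B' R3] fg comaximal_commute by blast+
  then have "R = diag_sum R1 R4"
    using R_eq R1 R4 by (simp add: diag_sum_def)
  then show ?thesis using that R1 R4 by blast
qed

text \<open>The matrix \<open>R\<close> that takes one adapted basis to the other is block diagonal. Its blocks are
  injective, so they have at least as many rows as columns, and as the total sizes agree they
  are square.\<close>

lemma adapted_unique:
  assumes fg: "comaximal f g" and n: "k + l = n" "k' + l' = n" and A: "A \<in> carrier_mat n n"
    and P: "P \<in> GL n" and P': "P' \<in> GL n"
    and ad: "adapted f g k l A P" and ad': "adapted f g k' l' A P'"
  shows "k' = k \<and> (\<exists>S \<in> GL k. \<exists>T \<in> GL l. P' = P * diag_sum S T)"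
proof -
  obtain B C where B: "B \<in> annihilated f k" and C: "C \<in> annihilated g l"
    and AP: "A * P = P * diag_sum B C" using ad by (auto simp: adapted_def)
  obtain B' C' where B': "B' \<in> annihilated f k'" and C': "C' \<in> annihilated g l'"
    and AP': "A * P' = P' * diag_sum B' C'" using ad' by (auto simp: adapted_def)
  obtain Q where Q: "Q \<in> GL n" "P * Q = 1\<^sub>m n" "Q * P = 1\<^sub>m n" using GL_inverse[OF P] .
  have D: "diag_sum B C \<in> carrier_mat n n" "diag_sum B' C' \<in> carrier_mat n n"
    using B C B' C' n diag_sum_carrier by (metis annihilated_carrier)+
  have c: "P \<in> carrier_mat n n" "P' \<in> carrier_mat n n" "Q \<in> carrier_mat n n" using P P' Q by auto
  define R where "R = Q * P'"
  have R: "R \<in> carrier_mat n n" using c by (auto simp: R_def)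
  have PR: "P' = P * R" using c Q(2) by (simp add: R_def assoc_mult_mat[of _ n n _ n _ n, symmetric] del: assoc_mult_mat)
  have "P * (diag_sum B C * R) = P * (R * diag_sum B' C')"
  proof -
    have "P * (diag_sum B C * R) = A * P'"
      using c D R A AP by (simp add: PR assoc_mult_mat[of _ n n _ n _ n, symmetric] del: assoc_mult_mat)
    also have "\<dots> = P * (R * diag_sum B' C')"
      unfolding AP' unfolding PR by (rule assoc_mult_mat[OF c(1) R D(2)])
    finally show ?thesis .
  qed
  moreover have "P \<in> inj_mats n n" using P by (simp add: inj_mats_square)
  ultimately have eq: "diag_sum B C * R = R * diag_sum B' C'"
    using inj_mats_cancel mult_carrier_mat[OF D(1) R] mult_carrier_mat[OF R D(2)] by blast
  obtain S T where S: "S \<in> carrier_mat k k'" and T: "T \<in> carrier_mat l l'" and R_eq: "R = diag_sum S T"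
    using intertwiner_block_diagonal[OF fg B C B' C' _ eq] R n by metis
  have "R \<in> inj_mats (k + l) (k' + l')"
    using inj_mats_mult_right[of Q n n P' n] inj_mats_mult_right[OF c(1) R] P' n by (simp add: inj_mats_square PR)
  then have ST: "S \<in> inj_mats k k'" "T \<in> inj_mats l l'"
    using inj_mats_diag_sum[OF S T] R_eq by auto
  then have "k' = k" "l' = l" using n by (auto dest!: inj_mats_le)
  then show ?thesis using ST PR R_eq by (auto simp: inj_mats_square)
qed

lemma adapted_mult:
  assumes A: "A \<in> carrier_mat (k + l) (k + l)" and P: "P \<in> GL (k + l)"
    and ad: "adapted f g k l A P" and S: "S \<in> GL k" and T: "T \<in> GL l"
  shows "adapted f g k l A (P * diag_sum S T)" "P * diag_sum S T \<in> GL (k + l)"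
proof -
  let ?n = "k + l"
  obtain B C where B: "B \<in> annihilated f k" and C: "C \<in> annihilated g l"
    and AP: "A * P = P * diag_sum B C" using ad by (auto simp: adapted_def)
  obtain S' where S': "S' \<in> GL k" "S * S' = 1\<^sub>m k" using GL_inverse[OF S] .
  obtain T' where T': "T' \<in> GL l" "T * T' = 1\<^sub>m l" using GL_inverse[OF T] .
  have c: "P \<in> carrier_mat ?n ?n" "S \<in> carrier_mat k k" "T \<in> carrier_mat l l" "B \<in> carrier_mat k k"
    "C \<in> carrier_mat l l" "S' \<in> carrier_mat k k" "T' \<in> carrier_mat l l"
    using P S T B C S' T' by auto
  have "diag_sum S T \<in> GL ?n"
    using S T inj_mats_diag_sum[OF c(2,3)] by (simp add: inj_mats_square)
  then show "P * diag_sum S T \<in> GL ?n" using inj_mats_mult[of P ?n ?n _ ?n] P by (simp add: inj_mats_square)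
  \<comment> \<open>changing the two partial bases conjugates the two diagonal blocks\<close>
  let ?B = "S' * B * S" and ?C = "T' * C * T"
  have BS: "B * S = S * ?B"
  proof -
    have "S * ?B = S * S' * B * S" using c by (simp add: assoc_mult_mat[of _ k k _ k _ k])
    then show ?thesis using c S' by simp
  qed
  have CT: "C * T = T * ?C"
  proof -
    have "T * ?C = T * T' * C * T" using c by (simp add: assoc_mult_mat[of _ l l _ l _ l])
    then show ?thesis using c T' by simp
  qed
  have BC': "?B \<in> carrier_mat k k" "?C \<in> carrier_mat l l" using c by (auto intro!: mult_carrier_mat)
  have "?B \<in> annihilated f k"
    using annihilated_pullback[OF _ B BC'(1) BS] S by (simp add: inj_mats_square)
  moreover have "?C \<in> annihilated g l"
    using annihilated_pullback[OF _ C BC'(2) CT] T by (simp add: inj_mats_square)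
  moreover have "A * (P * diag_sum S T) = P * diag_sum S T * diag_sum ?B ?C"
  proof -
    note d = diag_sum_carrier[OF c(2,3)] diag_sum_carrier[OF c(4,5)] diag_sum_carrier[OF BC']
    have "A * (P * diag_sum S T) = A * P * diag_sum S T"
      using A c d by (intro assoc_mult_mat[of _ ?n ?n _ ?n _ ?n, symmetric]) auto
    also have "\<dots> = P * (diag_sum B C * diag_sum S T)"
      unfolding AP using A c d by (intro assoc_mult_mat[of _ ?n ?n _ ?n _ ?n]) auto
    also have "diag_sum B C * diag_sum S T = diag_sum (B * S) (C * T)"
      by (rule diag_sum_mult[OF c(4,5,2,3)])
    also have "\<dots> = diag_sum (S * ?B) (T * ?C)"
      by (rule arg_cong2[of _ _ _ _ diag_sum, OF BS CT])
    also have "\<dots> = diag_sum S T * diag_sum ?B ?C"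
      by (rule diag_sum_mult[OF c(2,3) BC', symmetric])
    also have "P * (diag_sum S T * diag_sum ?B ?C) = P * diag_sum S T * diag_sum ?B ?C"
      using A c d by (intro assoc_mult_mat[of _ ?n ?n _ ?n _ ?n, symmetric]) auto
    finally show ?thesis .
  qed
  ultimately show "adapted f g k l A (P * diag_sum S T)" by (auto simp: adapted_def)
qed

text \<open>By the preceding two lemmas the adapted bases form a torsor under \<open>GL k\<close> times \<open>GL l\<close>.\<close>

lemma card_adapted:
  fixes f g :: "'a :: field poly"
  assumes fg: "comaximal f g" and A: "A \<in> carrier_mat (k + l) (k + l)"
    and P: "P \<in> GL (k + l)" and ad: "adapted f g k l A P"
  shows "card {P' \<in> GL (k + l). adapted f g k l A P'} = card (GL k :: 'a mat set) * card (GL l :: 'a mat set)"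
proof -
  have Pi: "P \<in> inj_mats (k + l) (k + l)" using P by (simp add: inj_mats_square)
  have "bij_betw (\<lambda>(S, T). P * diag_sum S T) (GL k \<times> GL l) {P' \<in> GL (k + l). adapted f g k l A P'}"
    unfolding bij_betw_def
  proof
    show "inj_on (\<lambda>(S, T). P * diag_sum S T) (GL k \<times> GL l)"
    proof (rule inj_onI; clarify)
      fix S T S' T'
      assume S: "S \<in> GL k" "T \<in> GL l" "S' \<in> GL k" "T' \<in> GL l" and "P * diag_sum S T = P * diag_sum S' T'"
      then have "diag_sum S T = diag_sum S' T'"
        using inj_mats_cancel[OF Pi diag_sum_carrier diag_sum_carrier] by blast
      then show "S = S' \<and> T = T'" using S diag_sum_eq_iff[of S k T l S' T'] by blast
    qed
    show "(\<lambda>(S, T). P * diag_sum S T) ` (GL k \<times> GL l) = {P' \<in> GL (k + l). adapted f g k l A P'}"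
    proof (intro Set.equalityI subsetI)
      fix P' assume "P' \<in> {P' \<in> GL (k + l). adapted f g k l A P'}"
      then have P': "P' \<in> GL (k + l)" "adapted f g k l A P'" by blast+
      have "\<exists>S \<in> GL k. \<exists>T \<in> GL l. P' = P * diag_sum S T"
        using adapted_unique[OF fg refl refl A P P'(1) ad P'(2)] by blast
      then show "P' \<in> (\<lambda>(S, T). P * diag_sum S T) ` (GL k \<times> GL l)" by auto
    next
      fix P' assume "P' \<in> (\<lambda>(S, T). P * diag_sum S T) ` (GL k \<times> GL l)"
      then obtain S T where S: "S \<in> GL k" and T: "T \<in> GL l" and P': "P' = P * diag_sum S T"
        by (elim imageE SigmaE) simp
      show "P' \<in> {P' \<in> GL (k + l). adapted f g k l A P'}"
        unfolding P' using adapted_mult[OF A P ad S T] by blast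
    qed
  qed
  from bij_betw_same_card[OF this, symmetric] show ?thesis unfolding card_cartesian_product .
qed

lemma finite_carrier_mat: "finite (carrier_mat n m :: 'a :: finite mat set)"
proof -
  have "carrier_mat n m \<subseteq> (\<lambda>h. mat n m h) ` (PiE ({..<n} \<times> {..<m}) (\<lambda>_. UNIV :: 'a set))"
  proof
    fix A :: "'a mat" assume "A \<in> carrier_mat n m"
    then have "A = mat n m (restrict (\<lambda>ij. A $$ ij) ({..<n} \<times> {..<m}))"
      by (auto simp: mat_eq_iff)
    then show "A \<in> (\<lambda>h. mat n m h) ` (PiE ({..<n} \<times> {..<m}) (\<lambda>_. UNIV :: 'a set))"
      by (intro image_eqI[of _ _ "restrict (\<lambda>ij. A $$ ij) ({..<n} \<times> {..<m})"]) auto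
  qed
  then show ?thesis by (rule finite_subset) (auto intro!: finite_imageI finite_PiE)
qed

lemma finite_annihilated: "finite (annihilated f n :: 'a :: {field,finite} mat set)"
  by (rule finite_subset[OF _ finite_carrier_mat[of n n]]) (auto simp: annihilated_def)

lemma finite_GL: "finite (GL n :: 'a :: {field,finite} mat set)"
  by (rule finite_subset[OF _ finite_carrier_mat[of n n]]) (auto simp: GL_def)

lemma card_GL: "card (GL n :: 'a :: {field,finite} mat set) = GL_order n CARD('a)"
  unfolding GL_def by (rule card_invertible_mat)

lemma card_GL_pos: "card (GL n :: 'a :: {field,finite} mat set) > 0"
proof -
  have "1\<^sub>m n \<in> (inj_mats n n :: 'a mat set)" by (auto simp: inj_mats_def)
  then show ?thesis using finite_GL card_gt_0_iff inj_mats_square by blast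
qed

text \<open>Both sides count pairs of a matrix \<open>A\<close> and an adapted basis \<open>P\<close>. For fixed \<open>P\<close> the matrix
  \<open>A\<close> is determined by its two diagonal blocks, which are arbitrary.\<close>

lemma sum_card_adapted:
  fixes f g :: "'a :: {field,finite} poly"
  shows "(\<Sum>A \<in> annihilated (f * g) (k + l). card {P \<in> GL (k + l). adapted f g k l A P})
     = card (GL (k + l) :: 'a mat set) * (card (annihilated f k) * card (annihilated g l))"
proof -
  let ?n = "k + l"
  have "(\<Sum>A \<in> annihilated (f * g) ?n. card {P \<in> GL ?n. adapted f g k l A P})
      = (\<Sum>P\<in>(GL ?n :: 'a mat set). card (annihilated f k) * card (annihilated g l))"
  proof (rule sum_multicount_gen[where R = "adapted f g k l", OF finite_annihilated finite_GL], rule ballI)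
    fix P :: "'a mat" assume P: "P \<in> GL ?n"
    obtain Q where Q: "Q \<in> GL ?n" "P * Q = 1\<^sub>m ?n" "Q * P = 1\<^sub>m ?n"
      using GL_inverse[OF P] .
    have c: "P \<in> carrier_mat ?n ?n" "Q \<in> carrier_mat ?n ?n" using P Q by auto
    have Pi: "P \<in> inj_mats ?n ?n" using P by (simp add: inj_mats_square)
    have d: "diag_sum B C \<in> carrier_mat ?n ?n" if "B \<in> annihilated f k" "C \<in> annihilated g l" for B C
      by (rule diag_sum_carrier[OF annihilated_carrier[OF that(1)] annihilated_carrier[OF that(2)]])
    have PQ: "P * D * Q * P = P * D" if "D \<in> carrier_mat ?n ?n" for D
      using c that Q by (simp add: assoc_mult_mat[of _ ?n ?n _ ?n _ ?n])
    have "bij_betw (\<lambda>(B, C). P * diag_sum B C * Q) (annihilated f k \<times> annihilated g l)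
        {A \<in> annihilated (f * g) ?n. adapted f g k l A P}"
      unfolding bij_betw_def
    proof
      show "inj_on (\<lambda>(B, C). P * diag_sum B C * Q) (annihilated f k \<times> annihilated g l)"
      proof (rule inj_onI; clarify)
        fix B C B' C'
        assume B: "B \<in> annihilated f k" "C \<in> annihilated g l" "B' \<in> annihilated f k" "C' \<in> annihilated g l"
          and eq: "P * diag_sum B C * Q = P * diag_sum B' C' * Q"
        have "P * diag_sum B C = P * diag_sum B' C'"
          using arg_cong[OF eq, of "\<lambda>M. M * P"] unfolding PQ[OF d[OF B(1,2)]] PQ[OF d[OF B(3,4)]] .
        then have "diag_sum B C = diag_sum B' C'"
          by (rule inj_mats_cancel[OF Pi d[OF B(1,2)] d[OF B(3,4)]])
        then show "B = B' \<and> C = C'" using B diag_sum_eq_iff[of B k C l B' C'] by blast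
      qed
      show "(\<lambda>(B, C). P * diag_sum B C * Q) ` (annihilated f k \<times> annihilated g l)
          = {A \<in> annihilated (f * g) ?n. adapted f g k l A P}"
      proof (intro Set.equalityI subsetI)
        fix A assume "A \<in> (\<lambda>(B, C). P * diag_sum B C * Q) ` (annihilated f k \<times> annihilated g l)"
        then obtain B C where B: "B \<in> annihilated f k" "C \<in> annihilated g l" and A: "A = P * diag_sum B C * Q"
          by (elim imageE SigmaE) simp
        have Ac: "A \<in> carrier_mat ?n ?n"
          unfolding A by (intro mult_carrier_mat[of _ _ ?n] c d B)
        have AP: "A * P = P * diag_sum B C" unfolding A by (rule PQ[OF d[OF B]])
        show "A \<in> {A \<in> annihilated (f * g) ?n. adapted f g k l A P}"
          using annihilated_pushforward[OF P Ac diag_sum_annihilated[OF annihilated_dvd[OF B(1) dvd_triv_left] annihilated_dvd[OF B(2) dvd_triv_right]] AP] AP B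
          unfolding adapted_def by blast
      next
        fix A assume "A \<in> {A \<in> annihilated (f * g) ?n. adapted f g k l A P}"
        then obtain B C where A: "A \<in> annihilated (f * g) ?n"
          and B: "B \<in> annihilated f k" "C \<in> annihilated g l" and AP: "A * P = P * diag_sum B C"
          unfolding adapted_def by blast
        have Ac: "A \<in> carrier_mat ?n ?n" using A by auto
        have "A = A * P * Q" using Ac c Q by (simp add: assoc_mult_mat[of _ ?n ?n _ ?n _ ?n])
        then have "A = P * diag_sum B C * Q" by (simp add: AP)
        then show "A \<in> (\<lambda>(B, C). P * diag_sum B C * Q) ` (annihilated f k \<times> annihilated g l)"
          using B by auto
      qed
    qed
    from bij_betw_same_card[OF this, symmetric]
    show "card {A \<in> annihilated (f * g) ?n. adapted f g k l A P}
        = card (annihilated f k) * card (annihilated g l)"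
      unfolding card_cartesian_product .
  qed
  then show ?thesis by simp
qed

definition annihilated_gf :: "'a :: {field,finite} poly \<Rightarrow> rat fps" where
  "annihilated_gf f = Abs_fps (\<lambda>n. of_nat (card (annihilated f n)) / of_nat (card (GL n :: 'a mat set)))"

text \<open>Each \<open>A\<close> has adapted bases for exactly one \<open>k\<close>, and then \<open>card (GL k) * card (GL l)\<close> of
  them. So weighting the double count of \<open>sum_card_adapted\<close> by the inverse of this number and
  summing over \<open>k\<close> counts every \<open>A\<close> once, which gives the convolution formula.\<close>

lemma annihilated_gf_mult:
  fixes f g :: "'a :: {field,finite} poly"
  assumes fg: "comaximal f g"
  shows "annihilated_gf (f * g) = annihilated_gf f * annihilated_gf g"
proof (rule fps_ext)
  fix n
  let ?\<gamma> = "\<lambda>n. of_nat (card (GL n :: 'a mat set)) :: rat"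
  let ?N = "\<lambda>f n. of_nat (card (annihilated (f :: 'a poly) n)) :: rat"
  let ?F = "\<lambda>A k. card {P \<in> GL n. adapted f g k (n - k) A P}"
  have pos: "?\<gamma> i \<noteq> 0" for i using card_GL_pos[where 'a = 'a, of i] by simp
  \<comment> \<open>only the dimension \<open>k\<close> of the \<open>f\<close>-part of \<open>A\<close> contributes to the sum\<close>
  have one: "(\<Sum>k\<in>{0..n}. of_nat (?F A k) / (?\<gamma> k * ?\<gamma> (n - k))) = 1" if A: "A \<in> annihilated (f * g) n" for A
  proof -
    obtain k l P B C where k: "k + l = n" and P: "P \<in> GL n"
      and B: "B \<in> annihilated f k" "C \<in> annihilated g l" "A * P = P * diag_sum B C"
      using coprime_splitting[OF fg A] .
    have Ac: "A \<in> carrier_mat n n" using A by auto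
    have l: "l = n - k" "k \<le> n" using k by auto
    have ad: "adapted f g k l A P" using B by (auto simp: adapted_def)
    have "?F A k' = 0" if "k' \<in> {0..n} - {k}" for k'
    proof -
      have "{P \<in> GL n. adapted f g k' (n - k') A P} = {}"
        using adapted_unique[OF fg k _ Ac P _ ad, of k' "n - k'"] that by auto
      then show ?thesis by (simp only: card.empty)
    qed
    then have "(\<Sum>k'\<in>{0..n}. of_nat (?F A k') / (?\<gamma> k' * ?\<gamma> (n - k')))
        = (\<Sum>k'\<in>{0..n}. if k' = k then of_nat (?F A k) / (?\<gamma> k * ?\<gamma> (n - k)) else 0)"
      by (intro sum.cong) auto
    also have "\<dots> = of_nat (?F A k) / (?\<gamma> k * ?\<gamma> (n - k))" using l by simp
    also have "?F A k = card (GL k :: 'a mat set) * card (GL (n - k) :: 'a mat set)"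
      using card_adapted[OF fg, of A k l P] k l(1) Ac P ad by simp
    finally show ?thesis using pos by simp
  qed
  have "?N (f * g) n = (\<Sum>A\<in>annihilated (f * g) n. 1)" by simp
  also have "\<dots> = (\<Sum>A\<in>annihilated (f * g) n. \<Sum>k\<in>{0..n}. of_nat (?F A k) / (?\<gamma> k * ?\<gamma> (n - k)))"
    using one by (intro sum.cong) simp_all
  also have "\<dots> = (\<Sum>k\<in>{0..n}. (\<Sum>A\<in>annihilated (f * g) n. of_nat (?F A k)) / (?\<gamma> k * ?\<gamma> (n - k)))"
    by (subst sum.swap) (simp add: sum_divide_distrib)
  also have "\<dots> = (\<Sum>k\<in>{0..n}. ?\<gamma> n * (?N f k * ?N g (n - k)) / (?\<gamma> k * ?\<gamma> (n - k)))"
  proof (intro sum.cong refl)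
    fix k assume "k \<in> {0..n}"
    then have "(\<Sum>A\<in>annihilated (f * g) n. of_nat (?F A k)) = ?\<gamma> n * (?N f k * ?N g (n - k))"
      using sum_card_adapted[where f = f and g = g and k = k and l = "n - k"] by (simp flip: of_nat_sum of_nat_mult)
    then show "(\<Sum>A\<in>annihilated (f * g) n. of_nat (?F A k)) / (?\<gamma> k * ?\<gamma> (n - k))
        = ?\<gamma> n * (?N f k * ?N g (n - k)) / (?\<gamma> k * ?\<gamma> (n - k))" by simp
  qed
  also have "\<dots> = ?\<gamma> n * (\<Sum>k\<in>{0..n}. (?N f k / ?\<gamma> k) * (?N g (n - k) / ?\<gamma> (n - k)))"
    by (simp add: sum_distrib_left)
  finally show "fps_nth (annihilated_gf (f * g)) n = fps_nth (annihilated_gf f * annihilated_gf g) n"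
    using pos[of n] by (simp add: annihilated_gf_def fps_mult_nth)
qed

section \<open>Matrices annihilated by an irreducible polynomial\<close>

text \<open>An element of least degree in the ideal generated by \<open>p\<close> and \<open>q\<close> divides both of them, and
  irreducibility leaves only units.\<close>

lemma irreducible_comaximal:
  fixes p q :: "'a :: field poly"
  assumes p: "irreducible p" and q: "\<not> p dvd q"
  shows "comaximal p q"
proof -
  let ?I = "\<lambda>h. \<exists>u v. u * p + v * q = h"
  have "p \<noteq> 0" using p by auto
  moreover have "?I p" by (rule exI[of _ 1], rule exI[of _ 0]) simp
  ultimately obtain h where h: "h \<noteq> 0" "?I h" and min: "\<And>r. r \<noteq> 0 \<Longrightarrow> ?I r \<Longrightarrow> degree h \<le> degree r"
    using arg_min_natI[of "\<lambda>h. h \<noteq> 0 \<and> ?I h" p degree] 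
      arg_min_nat_le[of "\<lambda>h. h \<noteq> 0 \<and> ?I h" _ degree] by blast
  obtain u v where uv: "u * p + v * q = h" using h by blast
  have dvd: "h dvd r" if r: "?I r" for r
  proof (rule ccontr)
    assume "\<not> h dvd r"
    then have nz: "r mod h \<noteq> 0" by (simp add: dvd_eq_mod_eq_0)
    obtain u' v' where uv': "u' * p + v' * q = r" using r by blast
    have "r mod h = r - r div h * h" by (simp add: minus_div_mult_eq_mod)
    also have "\<dots> = (u' - r div h * u) * p + (v' - r div h * v) * q"
      unfolding uv[symmetric] uv'[symmetric] by (simp add: algebra_simps)
    finally have "?I (r mod h)" by metis
    then have "degree h \<le> degree (r mod h)" using min nz by blast
    then show False using degree_mod_less'[of h r] h nz by simp
  qed
  have "h dvd p" by (rule dvd) (rule exI[of _ 1], rule exI[of _ 0], simp)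
  then have "h dvd 1 \<or> p dvd h" using p irreducibleD' by blast
  moreover have "h dvd q" by (rule dvd) (rule exI[of _ 0], rule exI[of _ 1], simp)
  ultimately have "h dvd 1" using q dvd_trans by blast
  then obtain w where w: "1 = h * w" by (elim dvdE)
  have "(w * u) * p + (w * v) * q = 1"
    unfolding w uv[symmetric] by (simp add: algebra_simps)
  then show ?thesis unfolding comaximal_def by blast
qed

definition companion :: "'a :: field poly \<Rightarrow> 'a mat" where
  "companion f = mat (degree f) (degree f) (\<lambda>(i,j).
     if Suc j = degree f then - coeff f i else if i = Suc j then 1 else 0)"

definition krylov :: "'a :: field mat \<Rightarrow> 'a vec \<Rightarrow> nat \<Rightarrow> 'a mat" where
  "krylov A v d = mat (dim_row A) d (\<lambda>(i,j). ((\<lambda>w. A *\<^sub>v w) ^^ j) v $ i)"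

lemma companion_carrier [simp]: "companion f \<in> carrier_mat (degree f) (degree f)"
  by (simp add: companion_def)

lemma funpow_mult_vec_carrier:
  assumes "A \<in> carrier_mat n n" "v \<in> carrier_vec n"
  shows "((\<lambda>w. A *\<^sub>v w) ^^ j) v \<in> carrier_vec n"
  by (induction j) (use assms in auto)

lemma krylov_carrier [simp]: "A \<in> carrier_mat n n \<Longrightarrow> krylov A v d \<in> carrier_mat n d"
  by (simp add: krylov_def)

lemma col_krylov:
  assumes "A \<in> carrier_mat n n" "v \<in> carrier_vec n" "j < d"
  shows "col (krylov A v d) j = ((\<lambda>w. A *\<^sub>v w) ^^ j) v"
  using assms funpow_mult_vec_carrier[OF assms(1,2), of j] by (auto simp: krylov_def)

lemma col_companion:
  assumes "Suc j < degree f"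
  shows "col (companion f) j = unit_vec (degree f) (Suc j)"
  using assms by (auto simp: companion_def vec_eq_iff)

lemma krylov_mult_vec:
  assumes A: "A \<in> carrier_mat n n" and v: "v \<in> carrier_vec n" and y: "y \<in> carrier_vec d"
    and p: "degree p < d" "\<And>i. i < d \<Longrightarrow> coeff p i = y $ i"
  shows "krylov A v d *\<^sub>v y = poly_mat p A *\<^sub>v v"
  using A v y p(2) funpow_mult_vec_carrier[OF A v]
  unfolding poly_mat_mult_vec[OF A v p(1)]
  by (auto simp: vec_eq_iff krylov_def scalar_prod_def atLeast0LessThan mult.commute intro!: sum.cong)

text \<open>In the cyclic subspace spanned by the iterates of \<open>v\<close> the operator acts by the companion
  matrix: it shifts the iterates, and the last one is reduced by \<open>f(A) v = 0\<close>.\<close>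

lemma krylov_intertwines:
  fixes f :: "'a :: field poly"
  assumes A: "A \<in> carrier_mat n n" and v: "v \<in> carrier_vec n"
    and f: "lead_coeff f = 1" "degree f > 0" and fv: "poly_mat f A *\<^sub>v v = 0\<^sub>v n"
  shows "A * krylov A v (degree f) = krylov A v (degree f) * companion f"
proof (rule mat_eq_colI)
  let ?d = "degree f" and ?K = "krylov A v (degree f)"
  have K: "?K \<in> carrier_mat n ?d" using A by simp
  fix j assume j: "j < ?d"
  have l: "col (A * ?K) j = ((\<lambda>w. A *\<^sub>v w) ^^ Suc j) v"
    using j A v K by (simp add: col_krylov col_mult2[OF A K])
  show "col (A * ?K) j = col (?K * companion f) j"
  proof (cases "Suc j < ?d")
    case True
    then show ?thesis
      unfolding l col_mult2[OF K companion_carrier j]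
      by (simp only: col_companion mult_mat_unit_vec[OF K] col_krylov[OF A v])
  next
    case False
    then have d: "?d = Suc j" using j by simp
    have "poly_mat f A *\<^sub>v v = vec n (\<lambda>r. \<Sum>i<Suc ?d. coeff f i * (((\<lambda>w. A *\<^sub>v w) ^^ i) v) $ r)"
      by (rule poly_mat_mult_vec[OF A v]) simp
    then have "((\<lambda>w. A *\<^sub>v w) ^^ ?d) v $ r = - (\<Sum>i<?d. coeff f i * (((\<lambda>w. A *\<^sub>v w) ^^ i) v) $ r)" if "r < n" for r
      using that fv f(1) by (simp add: vec_eq_iff eq_neg_iff_add_eq_0 add.commute)
    moreover have "(?K *\<^sub>v col (companion f) j) $ r = - (\<Sum>i<?d. coeff f i * (((\<lambda>w. A *\<^sub>v w) ^^ i) v) $ r)" if "r < n" for r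
    proof -
      have "(?K *\<^sub>v col (companion f) j) $ r = (\<Sum>i<?d. ?K $$ (r,i) * companion f $$ (i,j))"
        using that carrier_matD[OF K] j by (simp add: scalar_prod_def atLeast0LessThan companion_def)
      also have "\<dots> = (\<Sum>i<?d. - (coeff f i * (((\<lambda>w. A *\<^sub>v w) ^^ i) v) $ r))"
        using that A d by (intro sum.cong) (auto simp: krylov_def companion_def)
      finally show ?thesis by (simp add: sum_negf)
    qed
    ultimately show ?thesis
      unfolding l col_mult2[OF K companion_carrier j] d[symmetric]
      using funpow_mult_vec_carrier[OF A v, of ?d] K by (intro eq_vecI) auto
  qed
qed (rule mult_carrier_mat[OF A krylov_carrier[OF A]]
    mult_carrier_mat[OF krylov_carrier[OF A] companion_carrier])+

text \<open>Conversely, homomorphisms out of the cyclic module are determined by the image of the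
  generator.\<close>

lemma intertwiner_eq_krylov:
  assumes A: "A \<in> carrier_mat n n" and f: "degree f > 0"
    and L: "L \<in> carrier_mat n (degree f)" and eq: "A * L = L * companion f"
  shows "L = krylov A (col L 0) (degree f)"
proof (rule mat_eq_colI[OF L krylov_carrier[OF A]])
  have v: "col L 0 \<in> carrier_vec n" using L by (auto intro: carrier_vecI)
  fix j assume "j < degree f"
  then show "col L j = col (krylov A (col L 0) (degree f)) j"
  proof (induction j)
    case 0
    then show ?case using col_krylov[OF A v 0] by simp
  next
    case (Suc j)
    then have j: "j < degree f" by simp
    have "col L (Suc j) = L *\<^sub>v col (companion f) j"
      using Suc.prems by (simp only: col_companion mult_mat_unit_vec[OF L])
    also have "\<dots> = col (A * L) j" unfolding eq by (simp only: col_mult2[OF L companion_carrier j])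
    also have "\<dots> = A *\<^sub>v col L j" by (simp only: col_mult2[OF A L j])
    also have "\<dots> = ((\<lambda>w. A *\<^sub>v w) ^^ Suc j) (col L 0)"
      using Suc.IH[OF j] col_krylov[OF A v j] by simp
    finally show ?case using col_krylov[OF A v Suc.prems] by simp
  qed
qed

text \<open>The first unit vector generates the whole space under the companion matrix, and it is
  killed by \<open>f\<close>; as \<open>f\<close> of the matrix commutes with the matrix, everything is killed.\<close>

lemma companion_annihilated:
  fixes f :: "'a :: field poly"
  assumes f: "lead_coeff f = 1" "degree f > 0"
  shows "companion f \<in> annihilated f (degree f)"
proof -
  let ?d = "degree f" and ?C = "companion f"
  let ?e = "unit_vec ?d 0 :: 'a vec"
  have e: "?e \<in> carrier_vec ?d" by simp
  have pow: "((\<lambda>w. ?C *\<^sub>v w) ^^ j) ?e = unit_vec ?d j" if "j < ?d" for j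
    using that
  proof (induction j)
    case (Suc j)
    then show ?case
      by (simp add: mult_mat_unit_vec[OF companion_carrier] col_companion)
  qed simp
  \<comment> \<open>the last column of the companion matrix\<close>
  have last: "(((\<lambda>w. ?C *\<^sub>v w) ^^ ?d) ?e) $ r = - coeff f r" if "r < ?d" for r
  proof -
    obtain m where m: "?d = Suc m" using f by (cases ?d) auto
    have "((\<lambda>w. ?C *\<^sub>v w) ^^ ?d) ?e = ?C *\<^sub>v unit_vec ?d m" using pow[of m] m by simp
    also have "\<dots> = col ?C m" by (rule mult_mat_unit_vec[OF companion_carrier]) (simp add: m)
    finally show ?thesis using that m by (simp add: companion_def)
  qed
  have fe: "poly_mat f ?C *\<^sub>v ?e = 0\<^sub>v ?d"
  proof (rule eq_vecI)
    fix r assume "r < dim_vec (0\<^sub>v ?d :: 'a vec)"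
    then have r: "r < ?d" by simp
    have "(poly_mat f ?C *\<^sub>v ?e) $ r = (\<Sum>i<Suc ?d. coeff f i * (((\<lambda>w. ?C *\<^sub>v w) ^^ i) ?e) $ r)"
      unfolding poly_mat_mult_vec[OF companion_carrier e lessI] using r by simp
    also have "\<dots> = (\<Sum>i<?d. coeff f i * (if r = i then 1 else 0)) - coeff f r"
      using last[OF r] f(1) r by (simp add: pow)
    also have "\<dots> = 0" using r by (simp add: if_distrib cong: if_cong)
    finally show "(poly_mat f ?C *\<^sub>v ?e) $ r = 0\<^sub>v ?d $ r" using r by simp
  qed simp
  have "poly_mat f ?C = 0\<^sub>m ?d ?d"
  proof (rule mat_eq_colI)
    fix j assume j: "j < ?d"
    note F = poly_mat_carrier[OF companion_carrier, of f f]
    have "poly_mat f ?C *\<^sub>v (((\<lambda>w. ?C *\<^sub>v w) ^^ i) ?e) = 0\<^sub>v ?d" for i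
    proof (induction i)
      case (Suc i)
      let ?w = "((\<lambda>w. ?C *\<^sub>v w) ^^ i) ?e"
      have w: "?w \<in> carrier_vec ?d" by (rule funpow_mult_vec_carrier[OF companion_carrier e])
      have "poly_mat f ?C *\<^sub>v (?C *\<^sub>v ?w) = poly_mat f ?C * ?C *\<^sub>v ?w"
        by (rule assoc_mult_mat_vec[OF F companion_carrier w, symmetric])
      also have "poly_mat f ?C * ?C = ?C * poly_mat f ?C"
        using poly_mat_intertwine[OF companion_carrier companion_carrier companion_carrier refl, of f f] by simp
      also have "\<dots> *\<^sub>v ?w = ?C *\<^sub>v (poly_mat f ?C *\<^sub>v ?w)"
        by (rule assoc_mult_mat_vec[OF companion_carrier F w])
      finally show ?case using Suc.IH by (simp add: mult_mat_0_vec[OF companion_carrier])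
    qed (use fe in simp)
    from this[of j] show "col (poly_mat f ?C) j = col (0\<^sub>m ?d ?d) j"
      using j by (simp add: pow mult_mat_unit_vec[OF F])
  qed (rule poly_mat_carrier[OF companion_carrier] zero_carrier_mat)+
  then show ?thesis by (simp add: annihilated_def)
qed

lemma annihilated_mult_vec:
  "A \<in> annihilated f n \<Longrightarrow> v \<in> carrier_vec n \<Longrightarrow> poly_mat f A *\<^sub>v v = 0\<^sub>v n"
  by (simp add: annihilated_def vec_eq_iff)

text \<open>The columns of \<open>K\<close> span an \<open>A\<close>-invariant subspace. A nonzero polynomial \<open>p\<close> of degree
  below that of the irreducible \<open>f\<close> acts invertibly, so \<open>p(A) v\<close> lies in this subspace only if
  \<open>v\<close> does. This is linear independence over the field \<open>K[X]/(f)\<close>, expressed over the base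
  field.\<close>

lemma hcat_krylov_inj_iff:
  fixes f :: "'a :: field poly"
  assumes f: "irreducible f" "degree f > 0" and A: "A \<in> annihilated f n"
    and K: "K \<in> inj_mats n m" and C: "C \<in> carrier_mat m m" and AK: "A * K = K * C"
    and v: "v \<in> carrier_vec n"
  shows "hcat K (krylov A v (degree f)) \<in> inj_mats n (m + degree f) \<longleftrightarrow> v \<notin> mat_im K"
proof
  let ?d = "degree f" and ?L = "krylov A v (degree f)"
  have Ac: "A \<in> carrier_mat n n" and Kc: "K \<in> carrier_mat n m" using A K by auto
  have L: "?L \<in> carrier_mat n ?d" using Ac by simp
  {
    assume inj: "hcat K ?L \<in> inj_mats n (m + ?d)"
    show "v \<notin> mat_im K"
    proof
      assume "v \<in> mat_im K"
      then obtain x where x: "x \<in> carrier_vec m" "v = K *\<^sub>v x" using Kc by (auto simp: mat_im_def)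
      have "?L *\<^sub>v ((-1) \<cdot>\<^sub>v unit_vec ?d 0) = (-1) \<cdot>\<^sub>v v"
        using col_krylov[OF Ac v f(2)]
        by (simp only: mult_mat_vec[OF L unit_vec_carrier] mult_mat_unit_vec[OF L f(2)] funpow.simps id_apply)
      then have "K *\<^sub>v x + ?L *\<^sub>v ((-1) \<cdot>\<^sub>v unit_vec ?d 0) = 0\<^sub>v n"
        using v by (auto simp: x(2)[symmetric])
      then have "(-1) \<cdot>\<^sub>v unit_vec ?d 0 = (0\<^sub>v ?d :: 'a vec)"
        using inj_mats_hcatD(2)[OF inj Kc L x(1)] by simp
      then have "((-1) \<cdot>\<^sub>v unit_vec ?d 0) $ 0 = (0\<^sub>v ?d :: 'a vec) $ 0" by (rule arg_cong)
      then show False using f(2) by simp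
    qed
  next
    assume notin: "v \<notin> mat_im K"
    show "hcat K ?L \<in> inj_mats n (m + ?d)"
    proof (rule inj_mats_hcatI[OF K L])
      fix x y assume x: "x \<in> carrier_vec m" and y: "y \<in> carrier_vec ?d"
        and e: "K *\<^sub>v x + ?L *\<^sub>v y = 0\<^sub>v n"
      \<comment> \<open>\<open>?L *\<^sub>v y\<close> is the value at \<open>v\<close> of the polynomial with coefficients \<open>y\<close>\<close>
      define p where "p = Poly (list_of_vec y)"
      have coeff_p: "coeff p i = y $ i" if "i < ?d" for i
        using that y by (simp add: p_def nth_default_def list_of_vec_index)
      have "coeff p i = 0" if "i > ?d - 1" for i
        using that y f(2) by (simp add: p_def nth_default_def)
      then have "degree p \<le> ?d - 1" by (intro degree_le) blast
      then have deg: "degree p < ?d" using f(2) by simp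
      have Ly: "?L *\<^sub>v y = poly_mat p A *\<^sub>v v" by (rule krylov_mult_vec[OF Ac v y deg coeff_p])
      have "p = 0"
      proof (rule ccontr)
        assume "p \<noteq> 0"
        then have "\<not> f dvd p" using deg dvd_imp_degree_le by (metis leD)
        then obtain r s where rs: "r * f + s * p = 1"
          using irreducible_comaximal[OF f(1)] unfolding comaximal_def by blast
        have pv: "poly_mat h A *\<^sub>v v \<in> carrier_vec n" for h
          using mult_mat_vec_carrier[OF poly_mat_carrier[OF Ac] v] .
        have "v = poly_mat (r * f + s * p) A *\<^sub>v v" unfolding rs using Ac v by (simp add: poly_mat_1)
        also have "\<dots> = poly_mat (r * f) A *\<^sub>v v + poly_mat (s * p) A *\<^sub>v v"
          using Ac v by (simp add: poly_mat_add add_mult_distrib_mat_vec[OF poly_mat_carrier poly_mat_carrier])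
        also have "poly_mat (r * f) A *\<^sub>v v = 0\<^sub>v n"
          by (rule annihilated_mult_vec[OF annihilated_dvd[OF A] v]) simp
        also have "0\<^sub>v n + poly_mat (s * p) A *\<^sub>v v = poly_mat s A *\<^sub>v (?L *\<^sub>v y)"
          using pv[of "s * p"] by (simp add: poly_mat_mult_apply[OF Ac v] Ly)
        also have "?L *\<^sub>v y = K *\<^sub>v ((-1) \<cdot>\<^sub>v x)"
          unfolding mult_mat_vec[OF Kc x]
        proof (rule eq_vecI)
          fix i assume "i < dim_vec ((-1) \<cdot>\<^sub>v (K *\<^sub>v x))"
          then have "(K *\<^sub>v x + ?L *\<^sub>v y) $ i = 0" "i < n" using e Kc by simp_all
          then have "(K *\<^sub>v x) $ i + (?L *\<^sub>v y) $ i = 0" using carrier_matD[OF L] by simp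
          then show "(?L *\<^sub>v y) $ i = ((-1) \<cdot>\<^sub>v (K *\<^sub>v x)) $ i"
            using \<open>i < n\<close> Kc by (simp add: eq_neg_iff_add_eq_0 add.commute)
        qed (use Kc carrier_matD[OF L] in simp)
        also have "poly_mat s A *\<^sub>v \<dots> = poly_mat s A * K *\<^sub>v ((-1) \<cdot>\<^sub>v x)"
          using assoc_mult_mat_vec[OF poly_mat_carrier[OF Ac, of s] Kc, of "(-1) \<cdot>\<^sub>v x"] x by simp
        also have "poly_mat s A * K = K * poly_mat s C" by (rule poly_mat_intertwine[OF Ac Kc C AK])
        also have "\<dots> *\<^sub>v ((-1) \<cdot>\<^sub>v x) = K *\<^sub>v (poly_mat s C *\<^sub>v ((-1) \<cdot>\<^sub>v x))"
          using assoc_mult_mat_vec[OF Kc poly_mat_carrier[OF C, of s], of "(-1) \<cdot>\<^sub>v x"] x by simp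
        finally have "v = K *\<^sub>v (poly_mat s C *\<^sub>v ((-1) \<cdot>\<^sub>v x))" .
        moreover have "poly_mat s C *\<^sub>v ((-1) \<cdot>\<^sub>v x) \<in> carrier_vec (dim_col K)"
          using mult_mat_vec_carrier[OF poly_mat_carrier[OF C, of s], of "(-1) \<cdot>\<^sub>v x"] Kc x by simp
        ultimately show False using notin unfolding mat_im_def by (metis image_eqI)
      qed
      then show "y = 0\<^sub>v ?d" using coeff_p y by (auto simp: vec_eq_iff)
    qed
  }
qed

section \<open>Counting bases over the field of residues modulo an irreducible polynomial\<close>

text \<open>The model of a free module of rank \<open>j\<close> over \<open>K[X]/(f)\<close>.\<close>

primrec companion_sum :: "'a :: field poly \<Rightarrow> nat \<Rightarrow> 'a mat" where
  "companion_sum f 0 = 0\<^sub>m 0 0"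
| "companion_sum f (Suc j) = diag_sum (companion_sum f j) (companion f)"

text \<open>Ordered families of \<open>j\<close> vectors that are independent over the field \<open>K[X]/(f)\<close>, through
  which \<open>A\<close> makes the space a vector space. Each vector is represented by its Krylov block.\<close>

definition frames :: "'a :: field poly \<Rightarrow> 'a mat \<Rightarrow> nat \<Rightarrow> nat \<Rightarrow> 'a mat set" where
  "frames f A n j = {K \<in> inj_mats n (j * degree f). A * K = K * companion_sum f j}"

lemma companion_sum_annihilated:
  assumes f: "lead_coeff f = 1" "degree f > 0"
  shows "companion_sum f j \<in> annihilated f (j * degree f)"
proof (induction j)
  case 0
  show ?case by (auto simp: annihilated_def mat_eq_iff intro!: poly_mat_carrier)
next
  case (Suc j)
  then show ?case
    using diag_sum_annihilated[OF Suc companion_annihilated[OF f]] by (simp add: add.commute)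
qed

lemma card_carrier_vec: "card (carrier_vec n :: 'a :: finite vec set) = CARD('a) ^ n"
proof -
  have "bij_betw list_of_vec (carrier_vec n :: 'a vec set) {xs. set xs \<subseteq> UNIV \<and> length xs = n}"
    by (rule bij_betw_byWitness[where f' = vec_of_list]) (auto simp: vec_list list_vec intro: carrier_vecI)
  then show ?thesis
    using card_lists_length_eq[of "UNIV :: 'a set" n] by (simp add: bij_betw_same_card)
qed

lemma finite_carrier_vec: "finite (carrier_vec n :: 'a :: finite vec set)"
  by (rule card_ge_0_finite) (simp add: card_carrier_vec)

lemma mat_im_subset: "K \<in> carrier_mat n k \<Longrightarrow> mat_im K \<subseteq> carrier_vec n"
  by (auto simp: mat_im_def)

lemma card_mat_im:
  assumes "K \<in> inj_mats n k"
  shows "card (mat_im (K :: 'a :: {field,finite} mat)) = CARD('a) ^ k"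
proof -
  have "K \<in> carrier_mat n k" using assms by auto
  moreover have "inj_on (\<lambda>v. K *\<^sub>v v) (carrier_vec k)"
    using inj_mats_vec_cancel[OF assms] by (intro inj_onI) blast
  ultimately show ?thesis by (simp add: mat_im_def card_image card_carrier_vec)
qed

text \<open>A family of independent vectors is extended by any vector outside of its span.\<close>

lemma frames_Suc_bij:
  fixes f :: "'a :: field poly"
  assumes f: "irreducible f" "lead_coeff f = 1" "degree f > 0" and A: "A \<in> annihilated f n"
  shows "bij_betw (\<lambda>(K, v). hcat K (krylov A v (degree f)))
     (SIGMA K:frames f A n j. carrier_vec n - mat_im K) (frames f A n (Suc j))"
proof -
  let ?d = "degree f" and ?C = "companion_sum f j"
  have Ac: "A \<in> carrier_mat n n" using A by auto
  have C: "?C \<in> carrier_mat (j * ?d) (j * ?d)" using companion_sum_annihilated[OF f(2,3)] by auto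
  have dim: "Suc j * ?d = j * ?d + ?d" by simp
  note L = krylov_carrier[OF Ac, of _ ?d]
  show ?thesis
    unfolding bij_betw_def
  proof
    show "inj_on (\<lambda>(K, v). hcat K (krylov A v ?d)) (SIGMA K:frames f A n j. carrier_vec n - mat_im K)"
    proof (rule inj_onI; clarify)
      fix K v K' v'
      assume K: "K \<in> frames f A n j" "K' \<in> frames f A n j"
        and v: "v \<in> carrier_vec n" "v' \<in> carrier_vec n"
        and "hcat K (krylov A v ?d) = hcat K' (krylov A v' ?d)"
      moreover have "K \<in> carrier_mat n (j * ?d)" "K' \<in> carrier_mat n (j * ?d)"
        using K by (auto simp: frames_def)
      ultimately have "K = K'" and eq: "krylov A v ?d = krylov A v' ?d"
        using hcat_eq_iff[OF _ L _ L, of K "j * ?d" K'] by blast+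
      moreover have "v = v'"
        using arg_cong[OF eq, of "\<lambda>M. col M 0"] col_krylov[OF Ac v(1) f(3)] col_krylov[OF Ac v(2) f(3)]
        by simp
      ultimately show "K = K' \<and> v = v'" by simp
    qed
    show "(\<lambda>(K, v). hcat K (krylov A v ?d)) ` (SIGMA K:frames f A n j. carrier_vec n - mat_im K)
        = frames f A n (Suc j)"
    proof (intro Set.equalityI subsetI)
      fix M assume "M \<in> (\<lambda>(K, v). hcat K (krylov A v ?d)) ` (SIGMA K:frames f A n j. carrier_vec n - mat_im K)"
      then obtain K v where Kf: "K \<in> frames f A n j" and v: "v \<in> carrier_vec n" "v \<notin> mat_im K"
        and M: "M = hcat K (krylov A v ?d)" by (elim imageE SigmaE) (simp, blast)
      have K: "K \<in> inj_mats n (j * ?d)" and AK: "A * K = K * ?C" using Kf by (simp_all add: frames_def)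
      have Kc: "K \<in> carrier_mat n (j * ?d)" using K by auto
      have "A * M = hcat (A * K) (A * krylov A v ?d)" unfolding M by (rule mult_hcat[OF Ac Kc L])
      also have "\<dots> = hcat (K * ?C) (krylov A v ?d * companion f)"
        unfolding AK krylov_intertwines[OF Ac v(1) f(2,3) annihilated_mult_vec[OF A v(1)]] ..
      also have "\<dots> = M * companion_sum f (Suc j)"
        unfolding M companion_sum.simps by (rule hcat_mult_diag_sum[OF Kc L C companion_carrier, symmetric])
      finally have "A * M = M * companion_sum f (Suc j)" .
      moreover have "M \<in> inj_mats n (Suc j * ?d)"
        unfolding M dim using hcat_krylov_inj_iff[OF f(1,3) A K C AK v(1)] v(2) by blast
      ultimately show "M \<in> frames f A n (Suc j)" unfolding frames_def by blast
    next
      fix M assume Mf: "M \<in> frames f A n (Suc j)"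
      then have Minj: "M \<in> inj_mats n (j * ?d + ?d)" and AM: "A * M = M * diag_sum ?C (companion f)"
        unfolding frames_def dim by simp_all
      obtain K N where K: "K \<in> carrier_mat n (j * ?d)" and N: "N \<in> carrier_mat n ?d" and M: "M = hcat K N"
        using hcat_split[of M n "j * ?d" ?d] Minj by blast
      have "hcat (A * K) (A * N) = A * M" unfolding M by (rule mult_hcat[OF Ac K N, symmetric])
      also have "\<dots> = hcat (K * ?C) (N * companion f)"
        unfolding AM unfolding M by (rule hcat_mult_diag_sum[OF K N C companion_carrier])
      finally have AK: "A * K = K * ?C" and AN: "A * N = N * companion f"
        using hcat_eq_iff[OF mult_carrier_mat[OF Ac K] mult_carrier_mat[OF Ac N]
            mult_carrier_mat[OF K C] mult_carrier_mat[OF N companion_carrier]] by blast+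
      have Ki: "K \<in> inj_mats n (j * ?d)" using inj_mats_hcat_left[OF _ K N] Minj M by blast
      define v where "v = col N 0"
      have v: "v \<in> carrier_vec n" using N by (auto simp: v_def intro: carrier_vecI)
      have N_eq: "N = krylov A v ?d" unfolding v_def by (rule intertwiner_eq_krylov[OF Ac f(3) N AN])
      have "v \<notin> mat_im K"
        using hcat_krylov_inj_iff[OF f(1,3) A Ki C AK v] Minj unfolding M N_eq by blast
      moreover have "K \<in> frames f A n j" using Ki AK by (simp add: frames_def)
      ultimately have "(K, v) \<in> (SIGMA K:frames f A n j. carrier_vec n - mat_im K)" using v by blast
      then show "M \<in> (\<lambda>(K, v). hcat K (krylov A v ?d)) ` (SIGMA K:frames f A n j. carrier_vec n - mat_im K)"
        unfolding M N_eq by (rule rev_image_eqI) simp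
    qed
  qed
qed

text \<open>This is the count of linearly independent families over the field with \<open>q ^ degree f\<close>
  elements.\<close>

lemma card_frames:
  fixes f :: "'a :: {field,finite} poly"
  assumes f: "irreducible f" "lead_coeff f = 1" "degree f > 0" and A: "A \<in> annihilated f n"
  shows "finite (frames f A n j) \<and>
    card (frames f A n j) = (\<Prod>i<j. CARD('a) ^ n - CARD('a) ^ (i * degree f))"
proof (induction j)
  case 0
  have "A * K = K * 0\<^sub>m 0 0" if "K \<in> carrier_mat n 0" for K
    using that carrier_matD[OF annihilated_carrier[OF A]] by (auto simp: mat_eq_iff)
  moreover have "inj_mats n 0 = {mat n 0 (\<lambda>_. 0 :: 'a)}"
    by (auto simp: inj_mats_def mat_eq_iff)
  ultimately have "frames f A n 0 = {mat n 0 (\<lambda>_. 0)}"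
    unfolding frames_def by auto
  then show ?case by simp
next
  case (Suc j)
  let ?S = "SIGMA K:frames f A n j. carrier_vec n - mat_im K"
  have "card (carrier_vec n - mat_im K) = CARD('a) ^ n - CARD('a) ^ (j * degree f)"
    if "K \<in> frames f A n j" for K
  proof -
    have K: "K \<in> inj_mats n (j * degree f)" using that by (simp add: frames_def)
    have sub: "mat_im K \<subseteq> carrier_vec n" using mat_im_subset inj_mats_carrier[OF K] by blast
    have "card (carrier_vec n - mat_im K) = card (carrier_vec n :: 'a vec set) - card (mat_im K)"
      by (rule card_Diff_subset[OF finite_subset[OF sub finite_carrier_vec] sub])
    then show ?thesis by (simp only: card_carrier_vec card_mat_im[OF K])
  qed
  then have "card ?S = (\<Prod>i<Suc j. CARD('a) ^ n - CARD('a) ^ (i * degree f))"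
    using Suc by (subst card_SigmaI) (simp_all add: finite_carrier_vec)
  moreover have "finite ?S" using Suc by (intro finite_SigmaI) (simp_all add: finite_carrier_vec)
  ultimately show ?case
    using bij_betw_same_card[OF frames_Suc_bij[OF f A]] bij_betw_finite[OF frames_Suc_bij[OF f A]]
    by metis
qed

text \<open>Both sides count pairs of a matrix \<open>A\<close> and a basis of the space over \<open>K[X]/(f)\<close>. Written
  out over the base field such a basis is an arbitrary invertible matrix, and it determines \<open>A\<close>
  as a conjugate of \<open>companion_sum f j\<close>. For fixed \<open>A\<close> the number of bases is the order of a
  general linear group over the extension field, so that no such field has to be constructed.\<close>

lemma card_annihilated_irreducible:
  fixes f :: "'a :: {field,finite} poly"
  assumes f: "irreducible f" "lead_coeff f = 1" "degree f > 0" and n: "n = j * degree f"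
  shows "card (annihilated f n) * GL_order j (CARD('a) ^ degree f) = card (GL n :: 'a mat set)"
proof -
  let ?C = "companion_sum f j"
  have C: "?C \<in> annihilated f n" unfolding n by (rule companion_sum_annihilated[OF f(2,3)])
  then have Cc: "?C \<in> carrier_mat n n" by auto
  have "(\<Sum>A\<in>annihilated f n. card {K \<in> GL n. A * K = K * ?C}) = (\<Sum>K\<in>(GL n :: 'a mat set). 1)"
  proof (rule sum_multicount_gen[where R = "\<lambda>A K. A * K = K * ?C", OF finite_annihilated finite_GL], rule ballI)
    fix K :: "'a mat" assume K: "K \<in> GL n"
    obtain Q where Q: "Q \<in> GL n" "K * Q = 1\<^sub>m n" "Q * K = 1\<^sub>m n" using GL_inverse[OF K] .
    have c: "K \<in> carrier_mat n n" "Q \<in> carrier_mat n n" using K Q by auto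
    let ?A = "K * ?C * Q"
    have A: "?A \<in> carrier_mat n n" by (rule mult_carrier_mat[OF mult_carrier_mat[OF c(1) Cc] c(2)])
    have AK: "?A * K = K * ?C" using c Cc Q by (simp add: assoc_mult_mat[of _ n n _ n _ n])
    have "{A \<in> annihilated f n. A * K = K * ?C} = {?A}"
    proof (intro Set.equalityI subsetI)
      fix B assume "B \<in> {A \<in> annihilated f n. A * K = K * ?C}"
      then have B: "B \<in> annihilated f n" and BK: "B * K = K * ?C" by simp_all
      have Bc: "B \<in> carrier_mat n n" using B by auto
      have "B = B * (K * Q)" using Bc Q by simp
      also have "\<dots> = B * K * Q" by (rule assoc_mult_mat[OF Bc c, symmetric])
      finally show "B \<in> {?A}" unfolding BK by simp
    next
      fix B assume "B \<in> {?A}"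
      then show "B \<in> {A \<in> annihilated f n. A * K = K * ?C}"
        using annihilated_pushforward[OF K A C AK] AK by simp
    qed
    then show "card {A \<in> annihilated f n. A * K = K * ?C} = 1" by simp
  qed
  moreover have "card {K \<in> GL n. A * K = K * ?C} = GL_order j (CARD('a) ^ degree f)"
    if "A \<in> annihilated f n" for A
  proof -
    have "{K \<in> GL n. A * K = K * ?C} = frames f A n j"
      unfolding frames_def n[symmetric] by (simp add: inj_mats_square)
    then show ?thesis
      using card_frames[OF f that, of j] by (simp add: GL_order_def n power_mult[symmetric] mult.commute)
  qed
  ultimately show ?thesis by simp
qed

text \<open>If the degree of \<open>f\<close> does not divide \<open>n\<close>, then independent families over \<open>K[X]/(f)\<close> never
  exhaust the space, so they could be extended beyond dimension \<open>n\<close>.\<close>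

lemma annihilated_irreducible_empty:
  fixes f :: "'a :: {field,finite} poly"
  assumes f: "irreducible f" "lead_coeff f = 1" "degree f > 0" and n: "\<not> degree f dvd n"
  shows "annihilated f n = {}"
proof (rule ccontr)
  assume "annihilated f n \<noteq> {}"
  then obtain A where A: "A \<in> annihilated f n" by blast
  have q: "CARD('a) > 1"
    using card_mono[of UNIV "{0, 1 :: 'a}"] by simp
  \<comment> \<open>the least \<open>j\<close> for which \<open>j * degree f\<close> exceeds \<open>n\<close>\<close>
  let ?j = "Suc (n div degree f)"
  have "CARD('a) ^ (i * degree f) < CARD('a) ^ n" if "i < ?j" for i
  proof (rule power_strict_increasing[OF _ q])
    have "i * degree f \<le> n div degree f * degree f" using that by (intro mult_right_mono) auto
    also have "\<dots> \<le> n" by simp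
    finally have "i * degree f \<le> n" .
    moreover have "i * degree f \<noteq> n" using n by auto
    ultimately show "i * degree f < n" by simp
  qed
  then have "card (frames f A n ?j) > 0"
    using card_frames[OF f A, of ?j] by (auto intro!: prod_pos)
  then obtain K where "K \<in> frames f A n ?j" by (metis card.empty equals0I less_irrefl)
  then have "?j * degree f \<le> n" using inj_mats_le by (auto simp: frames_def)
  then show False using f(3) by (metis dividend_less_div_times mult_Suc not_less)
qed

lemma fps_nth_compose_X_power:
  fixes F :: "'a :: comm_ring_1 fps"
  assumes "d > 0"
  shows "fps_nth (F oo fps_X ^ d) n = (if d dvd n then fps_nth F (n div d) else 0)"
proof -
  have "fps_nth (F oo fps_X ^ d) n = (\<Sum>i=0..n. fps_nth F i * (if n = d * i then 1 else 0))"
    by (simp add: fps_compose_nth power_mult[symmetric])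
  also have "\<dots> = (\<Sum>i\<in>{0..n}. if i = n div d \<and> d dvd n then fps_nth F i else 0)"
    using assms by (intro sum.cong) auto
  also have "\<dots> = (if d dvd n then fps_nth F (n div d) else 0)"
    by (cases "d dvd n") simp_all
  finally show ?thesis .
qed

lemma annihilated_gf_irreducible:
  fixes f :: "'a :: {field,finite} poly"
  assumes f: "irreducible f" "lead_coeff f = 1" "degree f > 0"
  shows "annihilated_gf f = 1 + (Abs_fps (\<lambda>j. if j \<ge> 1
      then 1 / of_nat (GL_order j (CARD('a) ^ degree f)) else 0) oo fps_X ^ degree f)"
proof (rule fps_ext)
  fix n
  let ?d = "degree f"
  show "fps_nth (annihilated_gf f) n = fps_nth (1 + (Abs_fps (\<lambda>j. if j \<ge> 1
      then 1 / of_nat (GL_order j (CARD('a) ^ ?d)) else 0) oo fps_X ^ ?d)) n"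
  proof (cases "?d dvd n")
    case True
    then have n: "n = n div ?d * ?d" by simp
    let ?j = "n div ?d"
    have eq: "card (annihilated f n) * GL_order ?j (CARD('a) ^ ?d) = card (GL n :: 'a mat set)"
      by (rule card_annihilated_irreducible[OF f n])
    then have "GL_order ?j (CARD('a) ^ ?d) \<noteq> 0" "card (annihilated f n) \<noteq> 0"
      using card_GL_pos[where 'a = 'a, of n] by (metis mult_0_right mult_0 less_irrefl)+
    then have "of_nat (card (annihilated f n)) / of_nat (card (GL n :: 'a mat set))
        = 1 / (of_nat (GL_order ?j (CARD('a) ^ ?d)) :: rat)"
      unfolding eq[symmetric] by simp
    moreover have "GL_order 0 Q = 1" for Q by (simp add: GL_order_def)
    ultimately show ?thesis
      using True f(3) by (cases "n = 0")
        (auto simp: annihilated_gf_def fps_nth_compose_X_power Suc_le_eq elim!: dvdE)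
  next
    case False
    then have "n \<noteq> 0" by (intro notI) simp
    then show ?thesis
      using False annihilated_irreducible_empty[OF f False] f(3)
      by (simp add: annihilated_gf_def fps_nth_compose_X_power)
  qed
qed

section \<open>Products of distinct irreducible polynomials over a finite field\<close>

definition monic_irreducibles :: "nat \<Rightarrow> 'a :: field poly set" where
  "monic_irreducibles D = {p. lead_coeff p = 1 \<and> irreducible p \<and> degree p \<le> D}"

lemma irreducible_degree_pos: "irreducible (p :: 'a :: field poly) \<Longrightarrow> degree p > 0"
  by (metis irreducible_def is_unit_iff_degree not_gr_zero)

lemma finite_degree_le: "finite {p :: 'a :: {zero,finite} poly. degree p \<le> D}"
proof -
  have "{p :: 'a poly. degree p \<le> D} \<subseteq> Poly ` {xs. set xs \<subseteq> UNIV \<and> length xs \<le> Suc D}"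
  proof
    fix p :: "'a poly" assume "p \<in> {p. degree p \<le> D}"
    then have "length (coeffs p) \<le> Suc D" by (cases "p = 0") (simp_all add: length_coeffs_degree)
    then show "p \<in> Poly ` {xs. set xs \<subseteq> UNIV \<and> length xs \<le> Suc D}"
      by (intro image_eqI[of _ _ "coeffs p"]) simp_all
  qed
  then show ?thesis
    by (rule finite_subset) (intro finite_imageI finite_lists_length_le finite)
qed

lemma finite_monic_irreducibles: "finite (monic_irreducibles D :: 'a :: {field,finite} poly set)"
  by (rule finite_subset[OF _ finite_degree_le[of D]]) (auto simp: monic_irreducibles_def)

lemma monic_irreducible_dvd_eq:
  fixes p q :: "'a :: field poly"
  assumes "irreducible p" "lead_coeff p = 1" "irreducible q" "lead_coeff q = 1" "p dvd q"
  shows "p = q"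
proof -
  obtain r where q: "q = p * r" using assms(5) by (elim dvdE)
  have "\<not> p dvd 1" using assms(1) irreducible_def by blast
  then have "r dvd 1" using irreducibleD[OF assms(3) q] by blast
  then obtain c where "r = [:c:]" by (metis is_unit_polyE)
  moreover have "lead_coeff r = 1" using assms(2,4) q by (simp add: lead_coeff_mult)
  ultimately show ?thesis using q by simp
qed

lemma comaximal_prod:
  fixes p :: "'a :: field poly"
  assumes "finite S" "p \<notin> S" "irreducible p" "lead_coeff p = 1"
    "\<And>q. q \<in> S \<Longrightarrow> irreducible q \<and> lead_coeff q = 1"
  shows "comaximal p (\<Prod>S)"
proof (rule irreducible_comaximal[OF assms(3)])
  have prime: "prime_elem p" by (rule field_poly_irreducible_imp_prime[OF assms(3)])
  have "\<not> p dvd \<Prod>T" if "T \<subseteq> S" for T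
    using finite_subset[OF that assms(1)] that
  proof (induction T rule: finite_induct)
    case empty
    show ?case unfolding prod.empty using assms(3) irreducible_def by blast
  next
    case (insert q T)
    then have "\<not> p dvd q" using monic_irreducible_dvd_eq[OF assms(3,4)] assms(2,5) by blast
    then show ?case using insert prime_elem_dvd_mult_iff[OF prime] by simp
  qed
  then show "\<not> p dvd \<Prod>S" by blast
qed

text \<open>Distinct monic irreducibles are pairwise comaximal.\<close>

lemma prod_dvd_of_irreducibles:
  fixes h :: "'a :: field poly"
  assumes "finite S" "\<And>q. q \<in> S \<Longrightarrow> irreducible q \<and> lead_coeff q = 1" "\<And>q. q \<in> S \<Longrightarrow> q dvd h"
  shows "\<Prod>S dvd h"
  using assms
proof (induction S rule: finite_induct)
  case (insert p S)
  obtain u v where uv: "u * p + v * \<Prod>S = 1"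
    using comaximal_prod[of S p] insert unfolding comaximal_def by blast
  obtain r s where r: "h = p * r" and s: "h = \<Prod>S * s"
    using insert by (metis dvdE insert_iff)
  have "h = (u * p + v * \<Prod>S) * h" by (simp add: uv)
  also have "\<dots> = u * p * (\<Prod>S * s) + v * \<Prod>S * (p * r)"
    unfolding distrib_right r[symmetric] s[symmetric] ..
  also have "\<dots> = p * \<Prod>S * (u * s + v * r)" by (simp add: algebra_simps)
  finally show ?case using insert.hyps by (metis dvd_triv_left prod.insert)
qed simp

lemma prime_CHAR_finite: "prime CHAR('a :: {field,finite})"
  by (intro prime_CHAR_semidom finite_imp_CHAR_pos) simp

text \<open>Two of the powers \<open>X ^ (p ^ i)\<close> agree modulo \<open>f\<close>, as there are finitely many residues.
  Their difference is a \<open>p ^ i\<close>-th power of some \<open>X ^ (p ^ k) - X\<close> by Frobenius, and \<open>f\<close> is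
  prime. This is how separability of irreducible polynomials over finite fields enters:
  \<open>X ^ (p ^ k) - X\<close> has no multiple roots in any extension.\<close>

lemma irreducible_dvd_frobenius:
  fixes f :: "'a :: {field,finite} poly"
  assumes f: "irreducible f"
  shows "\<exists>k>0. f dvd [:0, 1:] ^ (CHAR('a) ^ k) - [:0, 1:]"
proof -
  let ?p = "CHAR('a)" and ?x = "[:0, 1:] :: 'a poly"
  have f0: "f \<noteq> 0" using f by auto
  have "range (\<lambda>i. ?x ^ (?p ^ i) mod f) \<subseteq> {r. degree r \<le> degree f}"
  proof
    fix r assume "r \<in> range (\<lambda>i. ?x ^ (?p ^ i) mod f)"
    then obtain i where "r = ?x ^ (?p ^ i) mod f" by blast
    then show "r \<in> {r. degree r \<le> degree f}"
      using degree_mod_less[OF f0, of "?x ^ (?p ^ i)"] by auto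
  qed
  then have "finite (range (\<lambda>i. ?x ^ (?p ^ i) mod f))"
    by (rule finite_subset) (rule finite_degree_le)
  then have "\<not> inj (\<lambda>i. ?x ^ (?p ^ i) mod f)"
    using finite_imageD infinite_UNIV_nat by blast
  then obtain i j where "i \<noteq> j" "?x ^ (?p ^ i) mod f = ?x ^ (?p ^ j) mod f"
    by (auto simp: inj_def)
  then obtain i j where ij: "i < j" "?x ^ (?p ^ i) mod f = ?x ^ (?p ^ j) mod f"
    by (metis linorder_neqE_nat)
  \<comment> \<open>\<open>X ^ (p ^ j) - X ^ (p ^ i)\<close> is the \<open>p ^ i\<close>-th power of \<open>X ^ (p ^ k) - X\<close>\<close>
  define k where "k = j - i"
  have prime: "prime CHAR('a poly)" using prime_CHAR_finite[where 'a = 'a] by simp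
  have "?x ^ (?p ^ j) = (?x ^ (?p ^ k) - ?x + ?x) ^ (?p ^ i)"
    using ij by (simp add: k_def power_mult[symmetric] power_add[symmetric])
  also have "\<dots> = (?x ^ (?p ^ k) - ?x) ^ (?p ^ i) + ?x ^ (?p ^ i)"
    by (rule freshmans_dream'[OF prime]) simp
  finally have "(?x ^ (?p ^ k) - ?x) ^ (?p ^ i) = ?x ^ (?p ^ j) - ?x ^ (?p ^ i)" by simp
  moreover have "f dvd ?x ^ (?p ^ j) - ?x ^ (?p ^ i)"
    using ij(2)[symmetric] by (simp add: mod_eq_dvd_iff)
  ultimately have "f dvd (?x ^ (?p ^ k) - ?x) ^ (?p ^ i)" by simp
  then have "f dvd ?x ^ (?p ^ k) - ?x"
    by (rule prime_elem_dvd_power[OF field_poly_irreducible_imp_prime[OF f]])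
  then show ?thesis using ij(1) k_def by (intro exI[of _ k]) simp
qed

lemma frobenius_dvd:
  fixes f :: "'a :: {field,finite} poly"
  assumes f: "f dvd [:0, 1:] ^ (CHAR('a) ^ k) - [:0, 1:]"
  shows "f dvd [:0, 1:] ^ (CHAR('a) ^ (k * m)) - [:0, 1:]"
proof (induction m)
  case (Suc m)
  let ?p = "CHAR('a)" and ?x = "[:0, 1:] :: 'a poly"
  have prime: "prime CHAR('a poly)" using prime_CHAR_finite[where 'a = 'a] by simp
  have "?x ^ (?p ^ (k * Suc m)) = (?x ^ (?p ^ (k * m)) - ?x + ?x) ^ (?p ^ k)"
    by (simp add: power_mult[symmetric] power_add[symmetric] add.commute)
  also have "\<dots> = (?x ^ (?p ^ (k * m)) - ?x) ^ (?p ^ k) + ?x ^ (?p ^ k)"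
    by (rule freshmans_dream'[OF prime]) simp
  finally have "?x ^ (?p ^ (k * Suc m)) - ?x = (?x ^ (?p ^ (k * m)) - ?x) ^ (?p ^ k) + (?x ^ (?p ^ k) - ?x)"
    by simp
  moreover have "f dvd (?x ^ (?p ^ (k * m)) - ?x) ^ (?p ^ k)"
    by (rule dvd_trans[OF Suc.IH dvd_power]) (simp add: finite_imp_CHAR_pos)
  ultimately show ?case using f by (metis dvd_add)
qed simp

lemma prod_irreducibles_dvd_frobenius:
  fixes S :: "'a :: {field,finite} poly set"
  assumes S: "finite S" "\<And>q. q \<in> S \<Longrightarrow> irreducible q \<and> lead_coeff q = 1"
  shows "\<exists>k>0. \<Prod>S dvd [:0, 1:] ^ (CHAR('a) ^ k) - [:0, 1:]"
proof -
  have "\<exists>k. \<forall>q\<in>S. k q > 0 \<and> q dvd [:0, 1:] ^ (CHAR('a) ^ k q) - [:0, 1:]"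
    using irreducible_dvd_frobenius S(2) by (intro bchoice) blast
  then obtain k where k: "\<And>q. q \<in> S \<Longrightarrow> k q > 0 \<and> q dvd [:0, 1:] ^ (CHAR('a) ^ k q) - [:0, 1:]"
    by blast
  let ?k = "prod k S"
  have "q dvd [:0, 1:] ^ (CHAR('a) ^ ?k) - [:0, 1:]" if "q \<in> S" for q
  proof -
    have "k q dvd ?k" using that S(1) by (intro dvd_prodI)
    then obtain m where "?k = k q * m" by (elim dvdE)
    then show ?thesis using frobenius_dvd[of q "k q" m] k[OF that] by simp
  qed
  moreover have "?k > 0" using k by (intro prod_pos) blast
  ultimately show ?thesis using prod_dvd_of_irreducibles[OF S] by blast
qed

section \<open>Semisimple matrices\<close>

text \<open>A multiple root would also be a root of the derivative.\<close>

lemma separable_splits: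
  fixes h :: "'a :: alg_closed_field poly"
  assumes sep: "\<And>x. poly h x = 0 \<Longrightarrow> poly (pderiv h) x \<noteq> 0" and h: "h \<noteq> 0"
  shows "\<exists>S. finite S \<and> h dvd (\<Prod>x\<in>S. [:-x, 1:])"
proof -
  obtain M where M: "h = smult (lead_coeff h) (\<Prod>x\<in>#M. [:-x, 1:])"
    using alg_closed_imp_factorization[OF h] by blast
  have "count M x \<le> 1" for x
  proof (rule ccontr)
    assume "\<not> count M x \<le> 1"
    then have "{#x, x#} \<subseteq># M" by (simp add: subseteq_mset_def)
    then obtain N where "M = {#x, x#} + N" by (metis mset_subset_eq_exists_conv)
    then have "h = [:-x, 1:] * ([:-x, 1:] * smult (lead_coeff h) (\<Prod>x\<in>#N. [:-x, 1:]))"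
      using M by (simp add: mult_ac)
    then obtain r where r: "h = [:-x, 1:] * ([:-x, 1:] * r)" by blast
    have "poly h x = 0" unfolding r by simp
    moreover have "poly (pderiv h) x = 0" unfolding r pderiv_mult poly_add poly_mult by simp
    ultimately show False using sep by blast
  qed
  then have "M = mset_set (set_mset M)"
    by (intro multiset_eqI) (auto simp: count_mset_set' not_in_iff Suc_le_eq intro: le_antisym)
  then have "(\<Prod>x\<in>#M. [:-x, 1:]) = (\<Prod>x\<in>set_mset M. [:-x, 1:])"
    by (simp add: prod_unfold_prod_mset)
  then have "h dvd (\<Prod>x\<in>set_mset M. [:-x, 1:])"
    using h by (subst M) (simp add: smult_dvd_iff)
  then show ?thesis by blast
qed

lemma frobenius_poly_splits:
  assumes "CHAR('a :: alg_closed_field) dvd Q" "Q > 0"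
  shows "\<exists>S. finite S \<and> [:0, 1 :: 'a:] ^ Q - [:0, 1:] dvd (\<Prod>x\<in>S. [:-x, 1:])"
proof (rule separable_splits)
  have Q: "of_nat Q = (0 :: 'a)" using assms(1) by (simp add: of_nat_eq_0_iff_char_dvd)
  have "pderiv ([:0, 1 :: 'a:] ^ Q - [:0, 1:]) = - 1"
  proof (cases Q)
    case (Suc m)
    then show ?thesis
      using Q by (simp add: pderiv_diff pderiv_power_Suc pderiv_pCons one_pCons del: of_nat_Suc power_Suc)
  qed (use assms(2) in simp)
  then show "poly (pderiv ([:0, 1 :: 'a:] ^ Q - [:0, 1:])) x \<noteq> 0"
    and "[:0, 1 :: 'a:] ^ Q - [:0, 1:] \<noteq> 0" for x
    by auto
qed

lemma one_mat_neq_0: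
  assumes "n > 0" shows "1\<^sub>m n \<noteq> (0\<^sub>m n n :: 'a :: zero_neq_one mat)"
proof
  assume "1\<^sub>m n = (0\<^sub>m n n :: 'a mat)"
  then have "1\<^sub>m n $$ (0, 0) = (0\<^sub>m n n :: 'a mat) $$ (0, 0)" by (rule arg_cong)
  then show False using assms by simp
qed

lemma similar_of_intertwine:
  assumes P: "P \<in> GL n" and A: "A \<in> carrier_mat n n" and B: "B \<in> carrier_mat n n" and eq: "A * P = P * B"
  shows "similar_mat A B"
proof -
  obtain Q where Q: "Q \<in> GL n" "P * Q = 1\<^sub>m n" "Q * P = 1\<^sub>m n" using GL_inverse[OF P] .
  have c: "P \<in> carrier_mat n n" "Q \<in> carrier_mat n n" using P Q by auto
  have "A = A * (P * Q)" using A Q by simp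
  also have "\<dots> = A * P * Q" by (rule assoc_mult_mat[OF A c, symmetric])
  finally have "A = P * B * Q" unfolding eq .
  then show ?thesis using A B c Q by (intro similar_matI[of A B P Q n]) auto
qed

text \<open>Splitting off one linear factor at a time by \<open>coprime_splitting\<close>; on the part that belongs
  to \<open>X - a\<close> the matrix is the scalar \<open>a\<close>.\<close>

lemma diagonalizable_of_annihilated:
  fixes S :: "'a :: field set"
  assumes "finite S" "A \<in> annihilated (\<Prod>x\<in>S. [:-x, 1:]) n"
  shows "\<exists>D. similar_mat A D \<and> diagonal_mat D"
  using assms
proof (induction S arbitrary: A n rule: finite_induct)
  case empty
  then have A: "A \<in> carrier_mat n n" by auto
  have "n = 0"
    using annihilatedD[OF empty] one_mat_neq_0[where 'a = 'a, of n] by (auto simp: poly_mat_1[OF A])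
  then show ?case using A similar_mat_refl[OF A] by (auto simp: diagonal_mat_def)
next
  case (insert a S)
  have "comaximal [:-a, 1:] (\<Prod>x\<in>S. [:-x, 1:])"
    using insert.hyps by (intro irreducible_comaximal irreducible_linear_field_poly)
      (auto simp: poly_eq_0_iff_dvd[symmetric] poly_prod)
  moreover have "A \<in> annihilated ([:-a, 1:] * (\<Prod>x\<in>S. [:-x, 1:])) n"
    using insert by simp
  ultimately obtain k l P B C where k: "k + l = n" and P: "P \<in> GL n" and B: "B \<in> annihilated [:-a, 1:] k"
    and C: "C \<in> annihilated (\<Prod>x\<in>S. [:-x, 1:]) l" and eq: "A * P = P * diag_sum B C"
    by (rule coprime_splitting)
  have c: "A \<in> carrier_mat n n" "B \<in> carrier_mat k k" "C \<in> carrier_mat l l"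
    using insert.prems B C by auto
  obtain D where D: "similar_mat C D" "diagonal_mat D" using insert.IH[OF C] by blast
  then have Dc: "D \<in> carrier_mat l l" using c(3) similar_matD by fastforce
  have BB: "B = a \<cdot>\<^sub>m 1\<^sub>m k"
  proof -
    have "(- a) \<cdot>\<^sub>m 1\<^sub>m k + B = 0\<^sub>m k k" using annihilatedD[OF B] by (simp add: poly_mat_linear[OF c(2)])
    then have "((- a) \<cdot>\<^sub>m 1\<^sub>m k + B) $$ (i,j) = 0" if "i < k" "j < k" for i j using that by simp
    then show ?thesis using c(2) by (auto simp: mat_eq_iff split: if_splits)
  qed
  have "similar_mat A (diag_sum B C)"
    using similar_of_intertwine[OF P c(1) _ eq] diag_sum_carrier[OF c(2,3)] k by simp
  moreover have "similar_mat (diag_sum B C) (diag_sum B D)"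
    using similar_mat_four_block_0_0[OF similar_mat_refl[OF c(2)] D(1) c(2,3)] c Dc
    by (simp add: diag_sum_def)
  moreover have "diagonal_mat (diag_sum B D)"
    using D(2) Dc unfolding BB by (auto simp: diagonal_mat_def diag_sum_def)
  ultimately show ?case using similar_mat_trans by blast
qed

interpretation to_ac: field_hom "to_ac :: 'a :: field \<Rightarrow> 'a alg_closure"
  by unfold_locales simp_all

interpretation to_ac_poly: map_poly_inj_idom_hom "to_ac :: 'a :: field \<Rightarrow> 'a alg_closure" ..

lemma poly_mat_hom:
  assumes "comm_ring_hom h" and A: "A \<in> carrier_mat n n"
  shows "poly_mat (map_poly h p) (map_mat h A) = map_mat h (poly_mat p A)"
proof -
  interpret comm_ring_hom h by fact
  interpret map_poly_hom: map_poly_comm_ring_hom h ..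
  have hA: "map_mat h A \<in> carrier_mat n n" using A by simp
  show ?thesis
  proof (induction p)
    case 0
    show ?case using A hA by (simp add: poly_mat_0) (auto simp: mat_eq_iff)
  next
    case (pCons a p)
    have "map_poly h (pCons a p) = pCons (h a) (map_poly h p)"
      by (rule map_poly_pCons_hom)
    then have "poly_mat (map_poly h (pCons a p)) (map_mat h A)
        = h a \<cdot>\<^sub>m 1\<^sub>m n + map_mat h (A * poly_mat p A)"
      by (simp add: poly_mat_pCons[OF hA] pCons.IH mat_hom_mult[OF A poly_mat_carrier[OF A]])
    also have "\<dots> = map_mat h (a \<cdot>\<^sub>m 1\<^sub>m n + A * poly_mat p A)"
      using A by (auto simp: mat_eq_iff hom_add simp del: index_mult_mat(1))
    finally show ?case by (simp add: poly_mat_pCons[OF A])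
  qed
qed

lemma annihilated_to_ac:
  "map_mat to_ac A \<in> annihilated (map_poly to_ac f) n \<longleftrightarrow> A \<in> annihilated f n"
proof (cases "A \<in> carrier_mat n n")
  case True
  have "poly_mat (map_poly to_ac f) (map_mat to_ac A) = map_mat to_ac (poly_mat f A)"
    by (rule poly_mat_hom[OF _ True]) unfold_locales
  moreover have "map_mat to_ac (poly_mat f A) = 0\<^sub>m n n \<longleftrightarrow> poly_mat f A = 0\<^sub>m n n"
    using poly_mat_carrier[OF True, of f] by (auto simp: mat_eq_iff)
  ultimately show ?thesis using True by (simp add: annihilated_def)
qed (auto simp: annihilated_def)

lemma poly_mat_diagonal:
  assumes D: "D \<in> carrier_mat n n" "diagonal_mat D"
  shows "poly_mat p D = mat n n (\<lambda>(i,j). if i = j then poly p (D $$ (i,i)) else 0)"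
proof (induction p)
  case 0
  show ?case using D by (auto simp: poly_mat_0 mat_eq_iff)
next
  case (pCons a p)
  show ?case
  proof (rule eq_matI)
    fix i j assume "i < dim_row (mat n n (\<lambda>(i,j). if i = j then poly (pCons a p) (D $$ (i,i)) else 0))"
      "j < dim_col (mat n n (\<lambda>(i,j). if i = j then poly (pCons a p) (D $$ (i,i)) else 0))"
    then have i: "i < n" and j: "j < n" by simp_all
    have "(D * poly_mat p D) $$ (i,j) = (\<Sum>k<n. D $$ (i,k) * (if k = j then poly p (D $$ (k,k)) else 0))"
      unfolding pCons.IH using D(1) i j by (auto simp: scalar_prod_def atLeast0LessThan intro!: sum.cong)
    also have "\<dots> = D $$ (i,j) * poly p (D $$ (j,j))"
      using j by (simp add: if_distrib cong: if_cong)
    finally show "poly_mat (pCons a p) D $$ (i,j)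
        = mat n n (\<lambda>(i,j). if i = j then poly (pCons a p) (D $$ (i,i)) else 0) $$ (i,j)"
      using D i j by (auto simp: poly_mat_pCons[OF D(1)] diagonal_mat_def simp del: index_mult_mat(1))
  qed (use D poly_mat_carrier[OF D(1)] in simp_all)
qed

text \<open>This is the minimal polynomial of \<open>x\<close>, obtained as a polynomial of least degree that
  vanishes at \<open>x\<close>. The bound on its degree is what makes the coefficients of the partial
  products stabilize.\<close>

lemma root_of_monic_irreducible:
  fixes f :: "'a :: field poly"
  assumes f: "f \<noteq> 0" "poly (map_poly to_ac f) x = 0"
  obtains p where "p \<in> monic_irreducibles (degree f)" "poly (map_poly to_ac p) x = 0"
proof -
  let ?R = "\<lambda>p :: 'a poly. p \<noteq> 0 \<and> poly (map_poly to_ac p) x = 0"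
  \<comment> \<open>monic representative of a polynomial of least degree with root \<open>x\<close>\<close>
  obtain r where r: "?R r" and min_r: "\<And>q. ?R q \<Longrightarrow> degree r \<le> degree q"
    using arg_min_natI[of ?R f degree] arg_min_nat_le[of ?R _ degree] f by blast
  define p where "p = smult (inverse (lead_coeff r)) r"
  have monic: "lead_coeff p = 1" and p: "?R p" and min: "\<And>q. ?R q \<Longrightarrow> degree p \<le> degree q"
    using r min_r by (simp_all add: p_def hom_distribs)
  have pos: "degree p > 0"
  proof (rule ccontr)
    assume "\<not> degree p > 0"
    then obtain c where "p = [:c:]" by (metis degree_eq_zeroE not_gr_zero)
    then show False using p by (auto simp: map_poly_pCons)
  qed
  have irr: "irreducible p"
  proof (rule irreducibleI)
    show "\<not> p dvd 1" using pos p by (simp add: is_unit_iff_degree)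
    fix a b assume ab: "p = a * b"
    then have nz: "a \<noteq> 0" "b \<noteq> 0" using p by auto
    have deg: "degree p = degree a + degree b" unfolding ab by (rule degree_mult_eq[OF nz])
    have "poly (map_poly to_ac a) x = 0 \<or> poly (map_poly to_ac b) x = 0"
      using p unfolding ab by (simp add: to_ac_poly.hom_mult)
    then have "degree p \<le> degree a \<or> degree p \<le> degree b" using min nz by blast
    then show "a dvd 1 \<or> b dvd 1" using deg nz by (auto simp: is_unit_iff_degree)
  qed (use p in simp)
  have "degree p \<le> degree f" using min f by blast
  then show ?thesis using that irr monic p by (simp add: monic_irreducibles_def)
qed

text \<open>If \<open>A\<close> is diagonalizable then its eigenvalues are roots of irreducible polynomials of
  degree at most \<open>n\<close>, by the characteristic polynomial, so the product kills the diagonal form.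
  Conversely the product divides some \<open>X ^ (p ^ k) - X\<close>, which splits into distinct linear
  factors over the algebraic closure.\<close>

lemma semisimple_iff_annihilated:
  fixes A :: "'a :: {field,finite} mat"
  assumes A: "A \<in> carrier_mat n n" and n: "n \<le> D"
  shows "semisimple_mat A \<longleftrightarrow> A \<in> annihilated (\<Prod>(monic_irreducibles D)) n"
proof
  let ?A = "map_mat to_ac A" and ?M = "\<Prod>(monic_irreducibles D) :: 'a poly"
  have Ac: "?A \<in> carrier_mat n n" using A by simp
  {
    assume "semisimple_mat A"
    then obtain E where sim: "similar_mat ?A E" and diag: "diagonal_mat E"
      by (auto simp: semisimple_mat_def)
    obtain m P Q where m: "{?A, E, P, Q} \<subseteq> carrier_mat m m" and PQ: "P * Q = 1\<^sub>m m" "Q * P = 1\<^sub>m m" "?A = P * E * Q"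
      using similar_matD[OF sim] by blast
    have "m = n" using m Ac by auto
    then have c: "E \<in> carrier_mat n n" "P \<in> carrier_mat n n" "Q \<in> carrier_mat n n" using m by auto
    have P: "P \<in> GL n" 
      using c PQ \<open>m = n\<close> by (auto simp: GL_def invertible_mat_def inverts_mat_def)
    have AP: "?A * P = P * E"
      unfolding PQ(3) using c PQ \<open>m = n\<close> by (simp add: assoc_mult_mat[of _ n n _ n _ n])
    have root: "poly (map_poly to_ac ?M) (E $$ (i,i)) = 0" if i: "i < n" for i
    proof -
      \<comment> \<open>the diagonal entries of \<open>E\<close> are eigenvalues, hence roots of the characteristic polynomial of \<open>A\<close>\<close>
      have "E *\<^sub>v unit_vec n i = E $$ (i,i) \<cdot>\<^sub>v unit_vec n i"
        using c(1) diag i by (auto simp: mult_mat_unit_vec[OF c(1) i] diagonal_mat_def vec_eq_iff)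
      then have "eigenvalue E (E $$ (i,i))"
        using c(1) i unfolding eigenvalue_def eigenvector_def
        by (intro exI[of _ "unit_vec n i"]) auto
      then have "poly (char_poly E) (E $$ (i,i)) = 0"
        using eigenvalue_root_char_poly[OF c(1)] by blast
      also have "char_poly E = map_poly to_ac (char_poly A)"
        using char_poly_similar[OF sim] to_ac.char_poly_hom[OF A] by simp
      finally have "poly (map_poly to_ac (char_poly A)) (E $$ (i,i)) = 0" .
      moreover have "char_poly A \<noteq> 0" "degree (char_poly A) = n"
        using degree_monic_char_poly[OF A] by auto
      ultimately obtain p where p: "p \<in> monic_irreducibles n" "poly (map_poly to_ac p) (E $$ (i,i)) = 0"
        using root_of_monic_irreducible by metis
      then have "p \<in> monic_irreducibles D" using n by (auto simp: monic_irreducibles_def)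
      then have "p dvd ?M" by (intro dvd_prodI[OF finite_monic_irreducibles, where f = "\<lambda>p. p"])
      then obtain r where "?M = p * r" by (elim dvdE)
      then show ?thesis using p(2) by (simp add: to_ac_poly.hom_mult)
    qed
    have "E \<in> annihilated (map_poly to_ac ?M) n"
      using c(1) root by (auto simp: annihilated_def poly_mat_diagonal[OF c(1) diag] mat_eq_iff)
    then show "A \<in> annihilated ?M n"
      using annihilated_pushforward[OF P Ac _ AP] annihilated_to_ac by blast
  next
    assume "A \<in> annihilated ?M n"
    obtain k where k: "k > 0" "?M dvd [:0, 1:] ^ (CHAR('a) ^ k) - [:0, 1:]"
      using prod_irreducibles_dvd_frobenius[OF finite_monic_irreducibles[of D]]
      by (auto simp: monic_irreducibles_def)
    then have "A \<in> annihilated ([:0, 1:] ^ (CHAR('a) ^ k) - [:0, 1:]) n"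
      using annihilated_dvd \<open>A \<in> annihilated ?M n\<close> by blast
    then have "?A \<in> annihilated (map_poly to_ac ([:0, 1:] ^ (CHAR('a) ^ k) - [:0, 1:])) n"
      by (simp only: annihilated_to_ac)
    also have "map_poly to_ac ([:0, 1:] ^ (CHAR('a) ^ k) - [:0, 1 :: 'a:])
        = [:0, 1:] ^ (CHAR('a) ^ k) - [:0, 1:]"
      by (simp add: hom_distribs map_poly_pCons)
    finally have "?A \<in> annihilated ([:0, 1:] ^ (CHAR('a) ^ k) - [:0, 1:]) n" .
    moreover obtain S where "finite S"
      "[:0, 1 :: 'a alg_closure:] ^ (CHAR('a) ^ k) - [:0, 1:] dvd (\<Prod>x\<in>S. [:-x, 1:])"
      using frobenius_poly_splits[where 'a = "'a alg_closure", of "CHAR('a) ^ k"] k(1)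
      by (auto simp: finite_imp_CHAR_pos)
    ultimately show "semisimple_mat A"
      unfolding semisimple_mat_def using diagonalizable_of_annihilated annihilated_dvd by blast
  }
qed

section \<open>The generating function of semisimple matrices\<close>

lemma annihilated_gf_one: "annihilated_gf (1 :: 'a :: {field,finite} poly) = 1"
proof (rule fps_ext)
  fix n
  have "annihilated (1 :: 'a poly) n = (if n = 0 then {1\<^sub>m 0} else {})"
  proof (cases n)
    case 0
    then show ?thesis by (auto simp: annihilated_def poly_mat_1 mat_eq_iff)
  next
    case (Suc m)
    then have "1\<^sub>m n \<noteq> (0\<^sub>m n n :: 'a mat)" by (intro one_mat_neq_0) simp
    then show ?thesis using Suc by (auto simp: annihilated_def poly_mat_1)
  qed
  moreover have "card (GL 0 :: 'a mat set) = 1" by (simp add: card_GL GL_order_def)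
  ultimately show "fps_nth (annihilated_gf (1 :: 'a poly)) n = fps_nth 1 n"
    by (simp add: annihilated_gf_def)
qed

lemma annihilated_gf_prod:
  fixes S :: "'a :: {field,finite} poly set"
  assumes "finite S" "\<And>q. q \<in> S \<Longrightarrow> irreducible q \<and> lead_coeff q = 1"
  shows "annihilated_gf (\<Prod>S) = (\<Prod>q\<in>S. annihilated_gf q)"
  using assms
proof (induction S rule: finite_induct)
  case (insert p S)
  then have "annihilated_gf (p * \<Prod>S) = annihilated_gf p * annihilated_gf (\<Prod>S)"
    by (intro annihilated_gf_mult comaximal_prod) auto
  then show ?case using insert by simp
qed (simp add: annihilated_gf_one)

theorem theorem18:
  fixes q :: nat and F :: "'a :: {field,finite} itself"
  assumes "q = CARD('a)"
  shows "(\<lambda>k. let d = Suc k in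
            (1 + (Abs_fps (\<lambda>j. if j \<ge> 1 then 1 / of_nat (GL_order j (q ^ d)) else 0) oo fps_X ^ d))
              ^ num_monic_irreducible F d)
         has_prod
         (1 + Abs_fps (\<lambda>n. if n \<ge> 1
            then of_nat (num_semisimple F n) / of_nat (GL_order n q) else 0) :: rat fps)"
proof -
  define H :: "nat \<Rightarrow> rat fps" where "H d = 1 + (Abs_fps (\<lambda>j. if j \<ge> 1
      then 1 / of_nat (GL_order j (q ^ d)) else 0) oo fps_X ^ d)" for d
  define G :: "rat fps" where "G = 1 + Abs_fps (\<lambda>n. if n \<ge> 1
      then of_nat (num_semisimple F n) / of_nat (GL_order n q) else 0)"
  let ?M = "\<lambda>D. \<Prod>(monic_irreducibles D) :: 'a poly"
  let ?I = "\<lambda>d. {p :: 'a poly. lead_coeff p = 1 \<and> irreducible p \<and> degree p = d}"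
  have fin: "finite (?I d)" for d
    by (rule finite_subset[OF _ finite_monic_irreducibles[of d]]) (auto simp: monic_irreducibles_def)
  have partial: "(\<Prod>k\<le>K. H (Suc k) ^ num_monic_irreducible F (Suc k)) = annihilated_gf (?M (Suc K))" for K
  proof -
    have "H (Suc k) ^ num_monic_irreducible F (Suc k) = (\<Prod>p\<in>?I (Suc k). annihilated_gf p)" for k
    proof -
      have "annihilated_gf p = H (Suc k)" if "p \<in> ?I (Suc k)" for p
      proof -
        have p: "irreducible p" "lead_coeff p = 1" "degree p = Suc k" using that by blast+
        show ?thesis
          unfolding H_def assms p(3)[symmetric]
          by (rule annihilated_gf_irreducible[OF p(1,2) irreducible_degree_pos[OF p(1)]])
      qed
      then have "(\<Prod>p\<in>?I (Suc k). annihilated_gf p) = (\<Prod>p\<in>?I (Suc k). H (Suc k))"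
        by (intro prod.cong) auto
      then show ?thesis by (simp add: num_monic_irreducible_def)
    qed
    then have "(\<Prod>k\<le>K. H (Suc k) ^ num_monic_irreducible F (Suc k))
        = (\<Prod>k\<le>K. \<Prod>p\<in>?I (Suc k). annihilated_gf p)" by simp
    also have "\<dots> = (\<Prod>p\<in>(\<Union>k\<le>K. ?I (Suc k)). annihilated_gf p)"
      using fin by (intro prod.UNION_disjoint[symmetric]) auto
    also have "(\<Union>k\<le>K. ?I (Suc k)) = monic_irreducibles (Suc K)"
    proof (intro Set.equalityI subsetI)
      fix p :: "'a poly" assume p: "p \<in> monic_irreducibles (Suc K)"
      then have "degree p > 0" by (auto simp: monic_irreducibles_def intro: irreducible_degree_pos)
      then obtain k where "degree p = Suc k" by (cases "degree p") auto
      then show "p \<in> (\<Union>k\<le>K. ?I (Suc k))" using p by (auto simp: monic_irreducibles_def)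
    qed (auto simp: monic_irreducibles_def)
    also have "(\<Prod>p\<in>(monic_irreducibles (Suc K) :: 'a poly set). annihilated_gf p) = annihilated_gf (?M (Suc K))"
      by (rule annihilated_gf_prod[OF finite_monic_irreducibles, symmetric])
        (simp add: monic_irreducibles_def)
    finally show ?thesis .
  qed
  have coeff: "fps_nth (annihilated_gf (?M D)) n = fps_nth G n" if "n \<le> D" for n D
  proof -
    have "annihilated (?M D) n = {A. A \<in> carrier_mat n n \<and> semisimple_mat A}"
      using semisimple_iff_annihilated[OF _ that] annihilated_carrier by blast
    then have ss: "card (annihilated (?M D) n) = num_semisimple F n"
      by (simp add: num_semisimple_def)
    show ?thesis
    proof (cases "n = 0")
      case True
      have "semisimple_mat (1\<^sub>m 0 :: 'a mat)"
        using semisimple_iff_annihilated[of "1\<^sub>m 0 :: 'a mat" 0 0]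
        by (simp add: annihilated_def mat_eq_iff poly_mat_dim[of _ 0])
      then have "{A :: 'a mat. A \<in> carrier_mat 0 0 \<and> semisimple_mat A} = {1\<^sub>m 0}"
        by (auto simp: mat_eq_iff)
      then show ?thesis
        using ss True by (simp add: annihilated_gf_def G_def card_GL num_semisimple_def GL_order_def)
    next
      case False
      then show ?thesis using ss by (simp add: annihilated_gf_def G_def card_GL assms)
    qed
  qed
  have "(\<lambda>K. \<Prod>k\<le>K. H (Suc k) ^ num_monic_irreducible F (Suc k)) \<longlonglongrightarrow> G"
  proof (rule tendsto_fpsI)
    fix n
    show "eventually (\<lambda>K. fps_nth (\<Prod>k\<le>K. H (Suc k) ^ num_monic_irreducible F (Suc k)) n = fps_nth G n) sequentially"
      using eventually_ge_at_top[of n] by eventually_elim (simp add: partial coeff)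
  qed
  moreover have "fps_nth G 0 \<noteq> 0" by (simp add: G_def)
  then have "G \<noteq> 0" by auto
  ultimately have "(\<lambda>k. H (Suc k) ^ num_monic_irreducible F (Suc k)) has_prod G"
    by (simp add: has_prod_def raw_has_prod_def)
  then show ?thesis by (simp add: H_def G_def Let_def)
qed

end
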